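(* There is an absolute constant $c>0$ such that for every integer $k\ge 3$, \[R(k+1,k+1)\le e^{-c(\log k)^2}\binom{2k}{k}.\]
   Context: For positive integers $k,\ell$, the Ramsey number $R(k,\ell)$ is the smallest positive integer $n$ such that every graph on $n$ vertices contains a clique of size $k$ or an independent set of size $\ell$. $\log$ denotes the natural logarithm. *)

theory Defs
  imports "HOL-Analysis.Analysis"
begin

text \<open>Simple graphs on the vertex set {0..<n}, given by a set E of 2-element
subsets (edges). Other elements of E are ignored.\<close>

definition is_clique :: "nat set set \<Rightarrow> nat set \<Rightarrow> bool" where
  "is_clique E K \<longleftrightarrow> (\<forall>u\<in>K. \<forall>v\<in>K. u \<noteq> v \<longrightarrow> {u, v} \<in> E)"

definition is_indep :: "nat set set \<Rightarrow> nat set \<Rightarrow> bool" where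
  "is_indep E K \<longleftrightarrow> (\<forall>u\<in>K. \<forall>v\<in>K. u \<noteq> v \<longrightarrow> {u, v} \<notin> E)"

definition ramsey_prop :: "nat \<Rightarrow> nat \<Rightarrow> nat \<Rightarrow> bool" where
  "ramsey_prop k l n \<longleftrightarrow>
     (\<forall>E. E \<subseteq> {e. e \<subseteq> {0..<n} \<and> card e = 2} \<longrightarrow>
        (\<exists>K \<subseteq> {0..<n}. card K = k \<and> is_clique E K) \<or>
        (\<exists>I \<subseteq> {0..<n}. card I = l \<and> is_indep E I))"

definition ramsey_number :: "nat \<Rightarrow> nat \<Rightarrow> nat" where
  "ramsey_number k l = (LEAST n. n > 0 \<and> ramsey_prop k l n)"

end

theory Submission
  imports Defs "HOL-Real_Asymp.Real_Asymp"
begin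

text \<open>For large \<open>k\<close> even \<open>R(k + 1, k + 1) \<le> 4^k exp (- c k)\<close> holds, by the method of Balister et al.
  (Upper bounds for multicolour Ramsey numbers). A maximal pair of cliques over a common
  neighbourhood that is larger than expected leaves a set \<open>W\<close> in which both colours have density
  close to \<open>1/2\<close>. In \<open>W\<close> one finds a monochromatic book with a spine of \<open>t\<close> vertices and about
  \<open>2^-t |W|\<close> pages, \<open>t\<close> a small constant times \<open>k\<close>; the Erdos-Szekeres bound for the resulting
  unbalanced Ramsey problem is smaller than \<open>2^(2k - t)\<close> by a factor exponential in \<open>t\<^sup>2/k\<close>. The book
  comes from a vertex-by-vertex algorithm driven by a correlation inequality: for two positive
  semidefinite kernels \<open>Z\<close>, \<open>Z'\<close> the mean of \<open>Z (2 + cosh \<surd>Z') + Z' (2 + cosh \<surd>Z)\<close> is non-negative,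
  as the power series has non-negative coefficients; hence for some \<open>n\<close> one kernel exceeds \<open>n\<^sup>2\<close>
  while the other is not very negative, with probability at least a constant times \<open>exp (- 3 n)\<close>.

  For small \<open>k\<close> it suffices that \<open>R(k + 1, k + 1)\<close> is strictly less than the binomial coefficient,
  which propagates from \<open>R(4, 4) \<le> 19\<close>.\<close>

section \<open>Correlation of positive semidefinite kernels\<close>

text \<open>Positive semidefinite kernels of finite rank, generated as finite sums of rank-one
  kernels. In this form positivity of the double sum and closure under products are direct
  inductions, without any spectral theory.\<close>

inductive gram :: "('a \<Rightarrow> 'a \<Rightarrow> real) \<Rightarrow> bool" where
  zero: "gram (\<lambda>_ _. 0)"
| step: "gram Z \<Longrightarrow> gram (\<lambda>x y. Z x y + f x * f y)"

lemma gram_rank1: "gram (\<lambda>x y. f x * f y)"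
  using gram.step[OF gram.zero, of f] by simp

lemma gram_add:
  assumes "gram Z" "gram W"
  shows "gram (\<lambda>x y. Z x y + W x y)"
  using assms(2)
proof induction
  case zero
  then show ?case using assms(1) by simp
next
  case (step W f)
  then show ?case using gram.step[of "\<lambda>x y. Z x y + W x y" f] by (simp add: add.assoc)
qed

lemma gram_sum:
  "(\<And>i. i \<in> I \<Longrightarrow> gram (Z i)) \<Longrightarrow> gram (\<lambda>x y. \<Sum>i\<in>I. Z i x y)"
  by (induction I rule: infinite_finite_induct) (auto intro: gram.zero gram_add)

lemma gram_mult_rank1: "gram Z \<Longrightarrow> gram (\<lambda>x y. Z x y * (f x * f y))"
proof (induction rule: gram.induct)
  case zero
  then show ?case using gram.zero by simp
next
  case (step Z g)
  have "gram (\<lambda>x y. Z x y * (f x * f y) + (g x * f x) * (g y * f y))"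
    by (rule gram.step) (fact step.IH)
  then show ?case by (simp add: algebra_simps)
qed

text \<open>The Schur product theorem: the entrywise product of two rank-one kernels has rank one
  again.\<close>

lemma gram_mult:
  assumes "gram Z" "gram W"
  shows "gram (\<lambda>x y. Z x y * W x y)"
  using assms(2)
proof induction
  case zero
  then show ?case using gram.zero by simp
next
  case (step W f)
  then show ?case using gram_add[OF step.IH gram_mult_rank1[OF assms(1), of f]]
    by (simp add: algebra_simps)
qed

lemma gram_scale:
  assumes "gram Z" "c \<ge> 0"
  shows "gram (\<lambda>x y. c * Z x y)"
  using gram_mult_rank1[OF assms(1), of "\<lambda>_. sqrt c"] assms(2) by (simp add: mult.commute)

lemma gram_power: "gram Z \<Longrightarrow> gram (\<lambda>x y. Z x y ^ n)"
proof (induction n)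
  case 0
  then show ?case using gram_rank1[of "\<lambda>_. 1"] by simp
next
  case (Suc n)
  then show ?case using gram_mult by simp
qed

lemma sum_gram_nonneg: "gram Z \<Longrightarrow> 0 \<le> (\<Sum>x\<in>X. \<Sum>y\<in>X. Z x y)"
proof (induction rule: gram.induct)
  case (step Z f)
  have "(\<Sum>x\<in>X. \<Sum>y\<in>X. f x * f y) = (\<Sum>x\<in>X. f x)\<^sup>2"
    by (simp add: power2_eq_square sum_product)
  then show ?case using step by (simp add: sum.distrib)
qed simp

section \<open>The entire function cosh of a square root\<close>

definition cosh_root :: "real \<Rightarrow> real" where
  "cosh_root x = (if x \<ge> 0 then cosh (sqrt x) else cos (sqrt (- x)))"

text \<open>The two branches of \<open>cosh_root\<close> are one power series, and all its
  coefficients are positive. This is what keeps \<open>cosh_root\<close> of a Gram kernel positive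
  semidefinite.\<close>

lemma cosh_root_sums: "(\<lambda>n. x ^ n / fact (2 * n)) sums cosh_root x"
proof (cases "x \<ge> 0")
  case True
  define f :: "nat \<Rightarrow> real" where "f = (\<lambda>m. if even m then sqrt x ^ m /\<^sub>R fact m else 0)"
  have f0: "f m = 0" if "m \<notin> range ((*) 2)" for m
  proof -
    have "odd m" using that by (metis dvdE rangeI)
    then show ?thesis by (simp add: f_def)
  qed
  have mono2: "strict_mono ((*) (2::nat))" by (rule strict_monoI) simp
  have "f sums cosh (sqrt x)"
    unfolding f_def by (rule cosh_converges)
  moreover have "(\<lambda>n. f (2 * n)) sums s \<longleftrightarrow> f sums s" for s
    using f0 by (intro sums_mono_reindex[OF mono2]) blast
  ultimately have "(\<lambda>n. f (2 * n)) sums cosh (sqrt x)" by blast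
  moreover have "f (2 * n) = sqrt x ^ (2 * n) /\<^sub>R fact (2 * n)" for n
    by (simp add: f_def)
  ultimately have "(\<lambda>n. sqrt x ^ (2 * n) /\<^sub>R fact (2 * n)) sums cosh (sqrt x)"
    by (simp only:)
  moreover have "sqrt x ^ (2 * n) /\<^sub>R fact (2 * n) = x ^ n / fact (2 * n)" for n
    using True by (simp add: power_mult divide_inverse)
  ultimately have "(\<lambda>n. x ^ n / fact (2 * n)) sums cosh (sqrt x)"
    by (simp only:)
  then show ?thesis using True by (simp add: cosh_root_def)
next
  case False
  have "(\<lambda>n. (- 1) ^ n / fact (2 * n) * sqrt (- x) ^ (2 * n)) sums cos (sqrt (- x))"
    by (rule cos_paired)
  moreover have "(- 1) ^ n / fact (2 * n) * sqrt (- x) ^ (2 * n) = x ^ n / fact (2 * n)" for n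
    using False by (simp add: power_mult flip: power_mult_distrib)
  ultimately show ?thesis using False by (simp add: cosh_root_def)
qed

lemma sum_gram_cosh_root_nonneg:
  assumes "gram Z" "gram W"
  shows "0 \<le> (\<Sum>x\<in>X. \<Sum>y\<in>X. Z x y * cosh_root (W x y))"
proof (rule sums_le)
  show "(\<lambda>n. \<Sum>x\<in>X. \<Sum>y\<in>X. Z x y * (W x y ^ n / fact (2 * n)))
      sums (\<Sum>x\<in>X. \<Sum>y\<in>X. Z x y * cosh_root (W x y))"
    by (intro sums_sum sums_mult cosh_root_sums)
  show "(\<lambda>n::nat. 0::real) sums 0" by simp
  fix n
  have "gram (\<lambda>x y. (1 / fact (2 * n)) * (Z x y * W x y ^ n))"
    by (intro gram_scale gram_mult assms gram_power) simp
  from sum_gram_nonneg[OF this, of X]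
  show "0 \<le> (\<Sum>x\<in>X. \<Sum>y\<in>X. Z x y * (W x y ^ n / fact (2 * n)))" by simp
qed

lemma cosh_root_ge_neg1: "- 1 \<le> cosh_root x"
  using cosh_real_ge_1[of "sqrt x"] by (simp add: cosh_root_def)

lemma cosh_root_ge:
  assumes "x \<ge> 0"
  shows "1 + x / 2 \<le> cosh_root x"
proof -
  have "(\<Sum>n\<in>{..<2}. x ^ n / fact (2 * n)) \<le> (\<Sum>n. x ^ n / fact (2 * n))"
    using assms by (intro sum_le_suminf) (auto intro: sums_summable[OF cosh_root_sums])
  then show ?thesis using sums_unique[OF cosh_root_sums[of x]]
    by (simp add: numeral_2_eq_2)
qed

lemma cosh_root_le: "cosh_root x \<le> exp (sqrt (max 0 x))"
  by (auto simp: cosh_root_def cosh_def max_def field_simps intro: order_trans[OF cos_le_one])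

lemma le_exp_sqrt:
  assumes "z \<ge> 0"
  shows "z \<le> 2 * exp (sqrt z)"
proof -
  have "1 + sqrt z + z / 2 \<le> exp (sqrt z)"
    using exp_lower_Taylor_quadratic[of "sqrt z"] assms by simp
  then show ?thesis using real_sqrt_ge_zero[OF assms] by linarith
qed

section \<open>A test function for two kernels\<close>

definition balance :: "real \<Rightarrow> real \<Rightarrow> real" where
  "balance z w = z * (2 + cosh_root w) + w * (2 + cosh_root z)"

lemma balance_commute: "balance z w = balance w z"
  by (simp add: balance_def)

text \<open>Since \<open>cosh_root\<close> is at least -1, adding 2 makes both factors at least 1.
  The threshold -6 is where the linear part \<open>w / 2\<close> of \<open>cosh_root w\<close>
  cancels the largest possible positive contribution \<open>3 * w\<close>.\<close>

lemma balance_le_neg1: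
  assumes "z \<le> - 6"
  shows "balance z w \<le> - 1"
proof (cases "w \<ge> 0")
  case True
  have "z * (2 + cosh_root w) \<le> - 6 * (2 + cosh_root w)"
    using assms cosh_root_ge_neg1[of w] by (intro mult_right_mono) auto
  moreover have "w * (2 + cosh_root z) \<le> w * 3"
    using True assms by (intro mult_left_mono) (auto simp: cosh_root_def)
  ultimately show ?thesis using cosh_root_ge[OF True] by (simp add: balance_def)
next
  case False
  have "z * (2 + cosh_root w) \<le> z * 1"
    using assms cosh_root_ge_neg1[of w] by (intro mult_left_mono_neg) auto
  moreover have "w * (2 + cosh_root z) \<le> 0"
    using False cosh_root_ge_neg1[of z] by (intro mult_nonpos_nonneg) auto
  ultimately show ?thesis using assms unfolding balance_def by linarith
qed

lemma balance_le: "balance z w \<le> 12 * exp (2 * sqrt (max 0 (max z w)))"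
proof -
  define M where "M = max 0 (max z w)"
  have part: "a * (2 + cosh_root b) \<le> 6 * exp (2 * sqrt M)" if "a \<le> M" "b \<le> M" for a b
  proof -
    have "cosh_root b \<le> exp (sqrt M)"
      using that by (intro order_trans[OF cosh_root_le]) (auto simp: M_def)
    moreover have "1 \<le> exp (sqrt M)" by (simp add: M_def)
    ultimately have "2 + cosh_root b \<le> 3 * exp (sqrt M)" by linarith
    then have "a * (2 + cosh_root b) \<le> M * (3 * exp (sqrt M))"
      using that cosh_root_ge_neg1[of b] by (intro mult_mono) (auto simp: M_def)
    also have "\<dots> \<le> (2 * exp (sqrt M)) * (3 * exp (sqrt M))"
      using le_exp_sqrt[of M] by (intro mult_right_mono) (auto simp: M_def)
    also have "\<dots> = 6 * exp (2 * sqrt M)" by (simp add: mult_exp_exp)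
    finally show ?thesis .
  qed
  have "z \<le> M" "w \<le> M" by (auto simp: M_def)
  from part[OF this] part[OF this(2,1)] show ?thesis
    unfolding balance_def M_def by linarith
qed

text \<open>The guaranteed gain in the favoured colour: at level 0 only a bounded loss, at level
  \<open>n > 0\<close> a gain of order \<open>n\<close> squared.\<close>

definition level :: "nat \<Rightarrow> real" where
  "level n = (if n = 0 then - 6 else (real n)\<^sup>2)"

lemma geometric_tail: "(\<Sum>n<N. exp (- real n)) \<le> 2"
proof -
  have r: "exp (- 1 :: real) \<le> 1 / 2"
    using exp_ge_add_one_self[of 1] by (simp add: exp_minus field_simps)
  have "(\<Sum>n<N. exp (- real n)) = (\<Sum>n<N. exp (- 1 :: real) ^ n)"
    by (simp add: exp_of_nat_mult[symmetric])
  also have "\<dots> \<le> (\<Sum>n<N. (1 / 2) ^ n)"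
    using r by (intro sum_mono power_mono) auto
  also have "\<dots> \<le> (\<Sum>n. (1 / 2) ^ n)"
    by (intro sum_le_suminf summable_geometric) auto
  also have "\<dots> = (2::real)" by (subst suminf_geometric) auto
  finally show ?thesis .
qed

text \<open>\<open>balance\<close> has nonnegative sum over all pairs, and every pair with a kernel
  value below -6 contributes at most -1. So the remaining pairs carry exponential weight
  \<open>exp (2 * sqrt M)\<close> proportional to all of \<open>X \<times> X\<close>. If every class
  were smaller than claimed, the rate \<open>exp (- 3 * n)\<close> would beat this weight and leave
  a convergent geometric series that is too small.\<close>

lemma gram_pair_correlation:
  fixes Z :: "bool \<Rightarrow> 'a \<Rightarrow> 'a \<Rightarrow> real"
  assumes X: "finite X" "X \<noteq> {}" and gram: "\<And>c. gram (Z c)"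
  shows "\<exists>n c. real (card {(x, y) \<in> X \<times> X. Z c x y \<ge> level n \<and> Z (\<not> c) x y \<ge> - 6})
    \<ge> exp (- 3 * real n) / 500 * (real (card X))\<^sup>2"
proof (rule ccontr)
  define S where "S c n = {(x, y) \<in> X \<times> X. Z c x y \<ge> level n \<and> Z (\<not> c) x y \<ge> - 6}" for c n
  define P where "P = X \<times> X"
  define G where "G = {p \<in> P. \<forall>c. Z c (fst p) (snd p) \<ge> - 6}"
  define M where "M p = max 0 (max (Z True (fst p) (snd p)) (Z False (fst p) (snd p)))" for p
  define m where "m p = nat \<lfloor>sqrt (M p)\<rfloor>" for p
  define b where "b p = balance (Z True (fst p) (snd p)) (Z False (fst p) (snd p))" for p
  assume "\<not> ?thesis"
  then have small: "real (card (S c n)) < exp (- 3 * real n) / 500 * (real (card X))\<^sup>2" for c n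
    unfolding S_def by (meson not_le_imp_less)
  have fin: "finite P" "finite G" using X by (auto simp: P_def G_def)
  have cardP: "real (card P) = (real (card X))\<^sup>2"
    by (simp add: P_def card_cartesian_product power2_eq_square)
  have "0 \<le> (\<Sum>x\<in>X. \<Sum>y\<in>X. 2 * Z True x y + 2 * Z False x y
      + Z True x y * cosh_root (Z False x y) + Z False x y * cosh_root (Z True x y))"
    using sum_gram_nonneg[OF gram[of True], of X] sum_gram_nonneg[OF gram[of False], of X]
      sum_gram_cosh_root_nonneg[OF gram[of True] gram[of False], of X]
      sum_gram_cosh_root_nonneg[OF gram[of False] gram[of True], of X]
    by (simp add: sum.distrib flip: sum_distrib_left)
  also have "\<dots> = (\<Sum>p\<in>P. b p)"
    by (simp add: P_def b_def balance_def algebra_simps sum.cartesian_product case_prod_beta)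
  also have "\<dots> = (\<Sum>p\<in>G. b p) + (\<Sum>p\<in>P - G. b p)"
    using sum.subset_diff[of G P b] fin by (auto simp: G_def)
  also have "(\<Sum>p\<in>P - G. b p) \<le> (\<Sum>p\<in>P - G. - 1)"
  proof (rule sum_mono)
    fix p assume "p \<in> P - G"
    then obtain c where "Z c (fst p) (snd p) \<le> - 6"
      by (auto simp: G_def not_le dest: less_imp_le)
    then show "b p \<le> - 1"
      using balance_le_neg1[of "Z c (fst p) (snd p)" "Z (\<not> c) (fst p) (snd p)"]
      by (cases c) (auto simp: b_def balance_commute)
  qed
  also have "(\<Sum>p\<in>G. b p) \<le> (\<Sum>p\<in>G. 12 * exp (2 * sqrt (M p)))"
    by (intro sum_mono) (simp add: b_def M_def balance_le)
  finally have bad: "real (card (P - G)) \<le> 12 * (\<Sum>p\<in>G. exp (2 * sqrt (M p)))"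
    by (simp add: sum_distrib_left)
  have "real (card G) = (\<Sum>p\<in>G. 1)" by simp
  also have "\<dots> \<le> (\<Sum>p\<in>G. exp (2 * sqrt (M p)))"
    by (intro sum_mono) (simp add: M_def)
  finally have "real (card P) \<le> 13 * (\<Sum>p\<in>G. exp (2 * sqrt (M p)))"
    using bad card_Diff_subset[of G P] fin card_mono[of P G]
    by (simp add: G_def subset_eq of_nat_diff)
  also have "(\<Sum>p\<in>G. exp (2 * sqrt (M p))) \<le> (\<Sum>p\<in>G. exp (2 * real (m p) + 2))"
  proof (intro sum_mono)
    fix p
    have "sqrt (M p) \<le> real (m p) + 1" by (simp add: m_def M_def)
    then show "exp (2 * sqrt (M p)) \<le> exp (2 * real (m p) + 2)" by simp
  qed
  also have "\<dots> = (\<Sum>n\<in>m ` G. \<Sum>p\<in>{p. p \<in> G \<and> m p = n}. exp (2 * real (m p) + 2))"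
    by (rule sum.image_gen) (rule fin)
  also have "\<dots> = (\<Sum>n\<in>m ` G. real (card {p. p \<in> G \<and> m p = n}) * exp (2 * real n + 2))"
    by (intro sum.cong) auto
  also have "\<dots> \<le> (\<Sum>n\<in>m ` G. (card P / 250) * exp 2 * exp (- real n))"
  proof (rule sum_mono)
    fix n
    \<comment> \<open>As \<open>n\<close> is the floor of the root of the larger kernel value, one
      colour reaches \<open>level n\<close>; for \<open>n = 0\<close> membership in \<open>G\<close>
      already says so.\<close>
    have "{p. p \<in> G \<and> m p = n} \<subseteq> S True n \<union> S False n"
    proof
      fix p assume p: "p \<in> {p. p \<in> G \<and> m p = n}"
      have "real n \<le> sqrt (M p)" using p by (auto simp: m_def M_def)
      then have "(real n)\<^sup>2 \<le> (sqrt (M p))\<^sup>2" by (intro power_mono) auto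
      then have "(real n)\<^sup>2 \<le> M p" by (simp add: M_def)
      then have "n \<noteq> 0 \<Longrightarrow> (real n)\<^sup>2 \<le> Z True (fst p) (snd p) \<or> (real n)\<^sup>2 \<le> Z False (fst p) (snd p)"
        by (auto simp: M_def le_max_iff_disj)
      then show "p \<in> S True n \<union> S False n"
        using p by (cases p) (auto simp: S_def G_def P_def level_def)
    qed
    then have "card {p. p \<in> G \<and> m p = n} \<le> card (S True n \<union> S False n)"
      using X by (intro card_mono) (auto simp: S_def intro: finite_subset[of _ "X \<times> X"])
    also have "\<dots> \<le> card (S True n) + card (S False n)" by (rule card_Un_le)
    finally have "real (card {p. p \<in> G \<and> m p = n}) \<le> real (card (S True n)) + real (card (S False n))"
      by linarith
    also have "\<dots> \<le> exp (- 3 * real n) / 250 * card P"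
      using small[of True n] small[of False n] by (simp add: cardP)
    finally have "real (card {p. p \<in> G \<and> m p = n}) * exp (2 * real n + 2)
        \<le> exp (- 3 * real n) / 250 * card P * exp (2 * real n + 2)"
      by (intro mult_right_mono) auto
    also have "\<dots> = (card P / 250) * (exp (- 3 * real n) * exp (2 * real n + 2))" by simp
    also have "exp (- 3 * real n) * exp (2 * real n + 2) = exp 2 * exp (- real n)"
      by (simp add: mult_exp_exp)
    finally show "real (card {p. p \<in> G \<and> m p = n}) * exp (2 * real n + 2)
        \<le> (card P / 250) * exp 2 * exp (- real n)" by (simp add: mult.assoc)
  qed
  also have "\<dots> = (card P / 250) * exp 2 * (\<Sum>n\<in>m ` G. exp (- real n))"
    by (simp add: sum_distrib_left)
  finally have *: "real (card P) \<le> 13 * ((card P / 250) * exp 2 * (\<Sum>n\<in>m ` G. exp (- real n)))"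
    by simp
  have "(\<Sum>n\<in>m ` G. exp (- real n)) \<le> (\<Sum>n<Suc (Max (m ` G)). exp (- real n))"
    using fin by (intro sum_mono2) (auto simp: less_Suc_eq_le)
  also have "\<dots> \<le> 2" by (rule geometric_tail)
  finally have s2: "(\<Sum>n\<in>m ` G. exp (- real n)) \<le> 2" .
  have "exp (2::real) = exp 1 * exp 1" by (simp add: mult_exp_exp)
  also have "\<dots> < 3 * 3" using exp_le e_less_272 by (intro mult_strict_mono) auto
  finally have e2: "exp (2::real) \<le> 9" by simp
  have "exp 2 * (\<Sum>n\<in>m ` G. exp (- real n)) \<le> 9 * 2"
    using e2 s2 by (intro mult_mono) (auto intro: sum_nonneg)
  then have "card P / 250 * (exp 2 * (\<Sum>n\<in>m ` G. exp (- real n))) \<le> card P / 250 * (9 * 2)"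
    by (rule mult_left_mono) simp
  \<comment> \<open>The constant 500 is large enough here: 13 * 18 < 250.\<close>
  then have "real (card P) \<le> 13 * (card P / 250 * 18)"
    using * by (simp only: mult.assoc)
  moreover have "card P > 0" using X by (simp add: P_def card_gt_0_iff)
  ultimately show False by simp
qed

section \<open>Erdos-Szekeres bounds\<close>

locale edge_colouring =
  fixes C :: "bool \<Rightarrow> 'a \<Rightarrow> 'a \<Rightarrow> bool"
  assumes sym: "C c x y \<Longrightarrow> C c y x"
    and irrefl: "\<not> C c x x"
    and total: "x \<noteq> y \<Longrightarrow> C True x y \<or> C False x y"
begin

definition monochromatic :: "bool \<Rightarrow> 'a set \<Rightarrow> bool" where
  "monochromatic c K \<longleftrightarrow> (\<forall>u\<in>K. \<forall>v\<in>K. u \<noteq> v \<longrightarrow> C c u v)"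

definition nbhd :: "bool \<Rightarrow> 'a \<Rightarrow> 'a set \<Rightarrow> 'a set" where
  "nbhd c x Y = {y \<in> Y. C c x y}"

lemma nbhd_subset: "nbhd c x Y \<subseteq> Y"
  by (auto simp: nbhd_def)

lemma finite_nbhd: "finite Y \<Longrightarrow> finite (nbhd c x Y)"
  using nbhd_subset finite_subset by metis

lemma monochromatic_insert:
  assumes "monochromatic c K" "\<And>u. u \<in> K \<Longrightarrow> C c x u"
  shows "monochromatic c (insert x K)"
  using assms sym unfolding monochromatic_def by blast

lemma monochromatic_extend:
  assumes "K \<subseteq> nbhd c v W" "finite W" "v \<in> W" "monochromatic c K" "card K = k"
  shows "\<exists>K'\<subseteq>W. card K' = Suc k \<and> monochromatic c K'"
proof (intro exI[of _ "insert v K"] conjI)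
  have "v \<notin> K" using assms(1) irrefl by (auto simp: nbhd_def)
  then show "card (insert v K) = Suc k"
    using assms finite_nbhd finite_subset by (metis card_insert_disjoint)
  show "monochromatic c (insert v K)"
    using assms by (intro monochromatic_insert) (auto simp: nbhd_def)
qed (use assms in \<open>auto simp: nbhd_def\<close>)

lemma ramsey_step:
  assumes "(\<exists>K\<subseteq>nbhd c v W. card K = a \<and> monochromatic c K) \<or>
      (\<exists>K\<subseteq>nbhd c v W. card K = b \<and> monochromatic d K)"
    and "finite W" "v \<in> W"
  shows "(\<exists>K\<subseteq>W. card K = Suc a \<and> monochromatic c K) \<or> (\<exists>K\<subseteq>W. card K = b \<and> monochromatic d K)"
  using assms(1)
proof
  assume "\<exists>K\<subseteq>nbhd c v W. card K = a \<and> monochromatic c K"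
  then obtain K where "K \<subseteq> nbhd c v W" "card K = a" "monochromatic c K" by blast
  from monochromatic_extend[OF this(1) assms(2,3) this(3,2)] show ?thesis ..
next
  assume "\<exists>K\<subseteq>nbhd c v W. card K = b \<and> monochromatic d K"
  then obtain K where K: "K \<subseteq> nbhd c v W" "card K = b" "monochromatic d K" by blast
  have "K \<subseteq> W" by (rule subset_trans[OF K(1) nbhd_subset])
  then show ?thesis using K by blast
qed

lemma card_nbhd_add:
  assumes "finite W"
  shows "card W \<le> card (nbhd c v W) + card (nbhd (\<not> c) v W) + 1"
proof -
  have "W \<subseteq> insert v (nbhd c v W \<union> nbhd (\<not> c) v W)"
    by (cases c) (auto simp: nbhd_def dest: not_sym[THEN total])
  then have "card W \<le> card (insert v (nbhd c v W \<union> nbhd (\<not> c) v W))"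
    using assms by (intro card_mono) (auto simp: finite_nbhd)
  also have "\<dots> \<le> card (nbhd c v W \<union> nbhd (\<not> c) v W) + 1"
    by (simp add: card_insert_le_m1 card_insert_if finite_nbhd assms)
  also have "\<dots> \<le> card (nbhd c v W) + card (nbhd (\<not> c) v W) + 1"
    by (simp add: card_Un_le)
  finally show ?thesis .
qed

text \<open>By Pascal's rule, if both neighbourhoods of \<open>v\<close> missed their binomial
  coefficients, then together with \<open>v\<close> they would still miss the sum by one. Cliques
  have size \<open>Suc a\<close> and \<open>Suc b\<close>, so the bound is the plain binomial
  coefficient.\<close>

lemma erdos_szekeres:
  assumes "finite W" "card W \<ge> (a + b) choose a"
  shows "(\<exists>K\<subseteq>W. card K = Suc a \<and> monochromatic c K) \<or> (\<exists>K\<subseteq>W. card K = Suc b \<and> monochromatic (\<not> c) K)"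
  using assms
proof (induction "a + b" arbitrary: a b W rule: less_induct)
  case less
  have "W \<noteq> {}" using less.prems by auto
  then obtain v where v: "v \<in> W" by blast
  show ?case
  proof (cases "a = 0 \<or> b = 0")
    case True
    have "{v} \<subseteq> W" "card {v} = Suc 0" "monochromatic d {v}" for d using v by (auto simp: monochromatic_def)
    then show ?thesis using True by blast
  next
    case False
    then obtain a' b' where ab: "a = Suc a'" "b = Suc b'" by (meson not0_implies_Suc)
    have "(a' + b choose a') + (a + b' choose a) \<le> card (nbhd c v W) + card (nbhd (\<not> c) v W) + 1"
      using less.prems card_nbhd_add[OF less.prems(1), of c v] by (simp add: ab)
    then consider "(a' + b choose a') \<le> card (nbhd c v W)" | "(a + b' choose a) \<le> card (nbhd (\<not> c) v W)"
      by linarith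
    then show ?thesis
    proof cases
      case 1
      then show ?thesis
        using ramsey_step[OF _ less.prems(1) v, of c a "Suc b" "\<not> c"]
          less.hyps[OF _ finite_nbhd[OF less.prems(1)] 1] by (simp add: ab)
    next
      case 2
      then show ?thesis
        using ramsey_step[OF _ less.prems(1) v, of "\<not> c" b "Suc a" c]
          less.hyps[OF _ finite_nbhd[OF less.prems(1)] 2] by (auto simp: ab)
    qed
  qed
qed

section \<open>Saving one vertex in the Erdos-Szekeres bound\<close>

lemma even_sum_degree:
  assumes "finite W"
  shows "even (\<Sum>v\<in>W. card (nbhd c v W))"
  using assms
proof induction
  case (insert w W)
  have "nbhd c w (insert w W) = nbhd c w W" using irrefl by (auto simp: nbhd_def)
  moreover have "card (nbhd c v (insert w W)) = card (nbhd c v W) + (if C c w v then 1 else 0)"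
    if "v \<in> W" for v
  proof -
    have "nbhd c v (insert w W) = (if C c w v then insert w (nbhd c v W) else nbhd c v W)"
      using sym by (auto simp: nbhd_def)
    moreover have "w \<notin> nbhd c v W" using insert.hyps by (auto simp: nbhd_def)
    ultimately show ?thesis using insert.hyps by (simp add: finite_nbhd)
  qed
  moreover have "(\<Sum>v\<in>W. if C c w v then 1 else 0) = card (nbhd c w W)"
    using insert.hyps by (simp add: nbhd_def flip: sum.inter_filter)
  ultimately have "(\<Sum>v\<in>insert w W. card (nbhd c v (insert w W)))
      = 2 * card (nbhd c w W) + (\<Sum>v\<in>W. card (nbhd c v W))"
    using insert.hyps by (simp add: sum.distrib)
  then show ?case using insert.IH by simp
qed simp

text \<open>A counterexample would be 9-regular in either colour, which parity excludes on 19 vertices.\<close>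

lemma monochromatic_four:
  assumes "finite W" "card W = 19"
  shows "\<exists>c. \<exists>K\<subseteq>W. card K = 4 \<and> monochromatic c K"
proof (rule ccontr)
  assume no: "\<not> ?thesis"
  have le: "card (nbhd c v W) \<le> 9" if "v \<in> W" for c v
  proof (rule ccontr)
    assume "\<not> ?thesis"
    \<comment> \<open>This is R(3,4) \<le> 10: a clique of size 3 in colour \<open>c\<close> extends
      by \<open>v\<close>, one of size 4 in the other colour is already forbidden.\<close>
    then have "card (nbhd c v W) \<ge> (2 + 3) choose 2" by (simp add: numeral_eq_Suc)
    from erdos_szekeres[OF finite_nbhd[OF assms(1)] this, of c]
    consider K where "K\<subseteq>nbhd c v W" "card K = 3" "monochromatic c K"
      | K where "K\<subseteq>nbhd c v W" "card K = 4" "monochromatic (\<not> c) K" by (auto simp: numeral_eq_Suc)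
    then show False
    proof cases
      case 1
      from monochromatic_extend[OF 1(1) assms(1) that 1(3,2)] no show ?thesis by (auto simp: numeral_eq_Suc)
    next
      case 2
      have "K \<subseteq> W" by (rule subset_trans[OF 2(1) nbhd_subset])
      then show ?thesis using no 2 by blast
    qed
  qed
  have "card (nbhd True v W) = 9" if "v \<in> W" for v
    using le[OF that, of True] le[OF that, of False] card_nbhd_add[OF assms(1), of True v] assms(2)
    by simp
  then have "(\<Sum>v\<in>W. card (nbhd True v W)) = 171" using assms by simp
  then show False using even_sum_degree[OF assms(1), of True] by simp
qed

text \<open>A saving of one vertex at (3,3), where 19 replaces 20, passes through Pascal's rule:
  either one neighbourhood meets the full bound, or the other meets its bound less one.\<close>

lemma erdos_szekeres_strict:
  assumes "finite W" "3 \<le> a" "3 \<le> b" "card W + 1 \<ge> (a + b) choose a"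
  shows "(\<exists>K\<subseteq>W. card K = Suc a \<and> monochromatic c K) \<or> (\<exists>K\<subseteq>W. card K = Suc b \<and> monochromatic (\<not> c) K)"
  using assms
proof (induction "a + b" arbitrary: a b W c rule: less_induct)
  case less
  have ch: "(3 + 3 choose 3) = (20::nat)" by (simp add: numeral_eq_Suc)
  show ?case
  proof (cases "a = 3 \<and> b = 3")
    case True
    then have "card W \<ge> 19" using less.prems ch by simp
    then obtain W' where W': "W' \<subseteq> W" "card W' = 19" by (rule obtain_subset_with_card_n) 
    then obtain d K where K: "K\<subseteq>W'" "card K = 4" "monochromatic d K"
      using monochromatic_four less.prems(1) finite_subset by metis
    then show ?thesis using True W' by (cases "d = c") (simp_all add: numeral_eq_Suc, blast+)
  next
    case False
    \<comment> \<open>Only \<open>b\<close> is lowered by induction. The branch lowering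
      \<open>a\<close> uses the full bound, because \<open>a - 1\<close> may drop to 2. The
      statement is general in \<open>a\<close>, \<open>b\<close>, \<open>c\<close> so that the case
      \<open>b = 3\<close> follows by exchanging the colours.\<close>
    have step: "(\<exists>K\<subseteq>W. card K = Suc a \<and> monochromatic c K) \<or> (\<exists>K\<subseteq>W. card K = Suc b \<and> monochromatic (\<not> c) K)"
      if hyps: "3 \<le> a" "3 < b" "card W + 1 \<ge> (a + b) choose a" "a + b = s"
        and IH: "\<And>a' b' W c. a' + b' < s \<Longrightarrow> finite W \<Longrightarrow> 3 \<le> a' \<Longrightarrow> 3 \<le> b' \<Longrightarrow>
          card W + 1 \<ge> (a' + b') choose a' \<Longrightarrow>
          (\<exists>K\<subseteq>W. card K = Suc a' \<and> monochromatic c K) \<or> (\<exists>K\<subseteq>W. card K = Suc b' \<and> monochromatic (\<not> c) K)"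
        and W: "finite W"
      for a b s W c
    proof -
      obtain a' b' where ab: "a = Suc a'" "b = Suc b'" using hyps by (metis Suc_le_D numeral_3_eq_3 less_imp_le)
      have "6 choose 3 \<le> (a + b) choose a"
      proof -
        have "(3 + 3 choose 3) \<le> (a + 3) choose 3" using hyps by (intro binomial_right_mono) auto
        also have "\<dots> = (a + 3) choose a" using binomial_symmetric[of a "a + 3"] by simp
        also have "\<dots> \<le> (a + b) choose a" using hyps by (intro binomial_right_mono) auto
        finally show ?thesis by simp
      qed
      then have "W \<noteq> {}" using hyps ch by auto
      then obtain v where v: "v \<in> W" by blast
      have "(a' + b choose a') + (a + b' choose a) \<le> card (nbhd c v W) + card (nbhd (\<not> c) v W) + 2"
        using hyps card_nbhd_add[OF W, of c v] by (simp add: ab)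
      then consider "(a' + b choose a') \<le> card (nbhd c v W)" | "(a + b' choose a) \<le> card (nbhd (\<not> c) v W) + 1"
        by linarith
      then show ?thesis
      proof cases
        case 1
        then show ?thesis
          using ramsey_step[OF _ W v, of c a "Suc b" "\<not> c"]
            erdos_szekeres[OF finite_nbhd[OF W] 1, of c] by (simp add: ab)
      next
        case 2
        have "a + b' < s" "3 \<le> b'" using hyps ab by auto
        from IH[OF this(1) finite_nbhd[OF W] hyps(1) this(2) 2, of c]
        show ?thesis
          using ramsey_step[OF _ W v, of "\<not> c" b "Suc a" c] by (auto simp: ab)
      qed
    qed
    show ?thesis
    proof (cases "b > 3")
      case True
      show ?thesis
        by (rule step[OF less.prems(2) True less.prems(4) refl _ less.prems(1)], rule less.hyps)
    next
      case b: False
      have ba: "(b + a) choose b = (a + b) choose a"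
        using binomial_symmetric[of a "a + b"] by (simp add: add.commute)
      have a3: "3 < a" and ch': "b + a choose b \<le> card W + 1" using less.prems False b ba by auto
      have "(\<exists>K\<subseteq>W. card K = Suc b \<and> monochromatic (\<not> c) K) \<or>
          (\<exists>K\<subseteq>W. card K = Suc a \<and> monochromatic (\<not> \<not> c) K)"
        by (rule step[OF less.prems(3) a3 _ add.commute _ less.prems(1)], fact ch', rule less.hyps)
      then show ?thesis by auto
    qed
  qed
qed

end

section \<open>Codegrees in a two-coloured complete graph\<close>

lemma gram_of_sum:
  "gram (\<lambda>x y. \<Sum>u\<in>Y. s x u * s y u)"
  by (intro gram_sum gram_rank1)

text \<open>The inner product of two normalised, centred indicators; each cross term equals
  \<open>1 / card Y\<close>. It turns codegrees into values of a Gram kernel.\<close>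

lemma sum_indicator_correlation:
  assumes "finite Y" "A \<subseteq> Y" "B \<subseteq> Y" "A \<noteq> {}" "B \<noteq> {}"
  shows "(\<Sum>u\<in>Y. (of_bool (u \<in> A) / card A - 1 / card Y) * (of_bool (u \<in> B) / card B - 1 / card Y))
    = real (card (A \<inter> B)) / (real (card A) * real (card B)) - 1 / card Y"
proof -
  have fin: "finite A" "finite B" using assms finite_subset by blast+
  have pos: "card A > 0" "card B > 0" "card Y > 0"
    using assms fin by (auto simp: card_gt_0_iff)
  have 1: "(\<Sum>u\<in>Y. of_bool (u \<in> A) :: real) = card A" if "A \<subseteq> Y" for A
    using that assms(1) by (simp add: of_bool_def flip: sum.inter_filter)
      (metis Collect_conj_eq Collect_mem_eq inf.absorb_iff2)
  have "(\<Sum>u\<in>Y. (of_bool (u \<in> A) / card A - 1 / card Y) * (of_bool (u \<in> B) / card B - 1 / card Y))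
    = (\<Sum>u\<in>Y. of_bool (u \<in> A \<inter> B) / (real (card A) * real (card B))
        - of_bool (u \<in> A) / (real (card A) * real (card Y)) - of_bool (u \<in> B) / (real (card B) * real (card Y))
        + 1 / (real (card Y))\<^sup>2)"
    by (intro sum.cong refl) (simp add: algebra_simps power2_eq_square of_bool_def)
  also have "\<dots> = real (card (A \<inter> B)) / (real (card A) * real (card B))
        - card A / (real (card A) * real (card Y)) - card B / (real (card B) * real (card Y))
        + real (card Y) / (real (card Y))\<^sup>2"
    using 1[of A] 1[of B] 1[of "A \<inter> B"] assms(2,3)
    by (simp add: sum.distrib sum_subtractf flip: sum_divide_distrib) (metis le_infI1)
  also have "\<dots> = real (card (A \<inter> B)) / (real (card A) * real (card B)) - 1 / card Y"
    using pos by (simp add: power2_eq_square)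
  finally show ?thesis .
qed

lemma exists_large_section:
  assumes "finite X" "X \<noteq> {}" "real (card {(x, y) \<in> X \<times> X. P x y}) \<ge> r * (real (card X))\<^sup>2"
  shows "\<exists>x\<in>X. real (card {y \<in> X. P x y}) \<ge> r * card X"
proof (rule ccontr)
  assume "\<not> ?thesis"
  then have "(\<Sum>x\<in>X. real (card {y \<in> X. P x y})) < (\<Sum>x\<in>X. r * card X)"
    using assms by (intro sum_strict_mono) auto
  moreover have "{(x, y) \<in> X \<times> X. P x y} = Sigma X (\<lambda>x. {y \<in> X. P x y})" by auto
  ultimately show False using assms by (simp add: card_SigmaI power2_eq_square mult_ac)
qed

context edge_colouring
begin

text \<open>The correlation inequality applied to the centred neighbourhoods, followed by averaging
  over \<open>x\<close>. Colour \<open>c\<close> gains \<open>level n\<close> units of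
  \<open>\<alpha> c\<close>, while the other colour loses at most 6 units.\<close>

lemma codegree_step:
  fixes p \<alpha> :: "bool \<Rightarrow> real"
  assumes X: "finite X" "X \<noteq> {}"
    and Y: "\<And>c. finite (Y c)" "\<And>c. Y c \<noteq> {}"
    and p: "\<And>c. p c > 0" and a: "\<And>c. \<alpha> c > 0"
    and deg: "\<And>c x. x \<in> X \<Longrightarrow> real (card (nbhd c x (Y c))) \<ge> p c * card (Y c)"
  shows "\<exists>n c. \<exists>x\<in>X. \<exists>X'\<subseteq>X. real (card X') \<ge> exp (- 3 * real n) / 500 * card X \<and>
    (\<forall>y\<in>X'. real (card (nbhd c y (nbhd c x (Y c)))) \<ge> (p c + level n * \<alpha> c) * card (nbhd c x (Y c)) \<and>
      real (card (nbhd (\<not> c) y (nbhd (\<not> c) x (Y (\<not> c)))))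
        \<ge> (p (\<not> c) - 6 * \<alpha> (\<not> c)) * card (nbhd (\<not> c) x (Y (\<not> c))))"
proof -
  define f where "f c x u = of_bool (u \<in> nbhd c x (Y c)) / card (nbhd c x (Y c)) - 1 / card (Y c)" for c x u
  \<comment> \<open>The scaling makes \<open>Z c x y \<ge> l\<close> say that the codegree, relative
    to the neighbourhood of \<open>x\<close>, is at least \<open>p c + l * \<alpha> c\<close>; the
    bound \<open>card B \<ge> p c * card (Y c)\<close> absorbs the normalisation.\<close>
  define Z where "Z c x y = (p c * card (Y c) / \<alpha> c) * (\<Sum>u\<in>Y c. f c x u * f c y u)" for c x y
  have gram: "gram (Z c)" for c
    unfolding Z_def using p[of c] a[of c] by (intro gram_scale gram_of_sum) (simp add: less_imp_le)
  have codeg: "real (card (nbhd c y (nbhd c x (Y c)))) \<ge> (p c + l * \<alpha> c) * card (nbhd c x (Y c))"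
    if xy: "x \<in> X" "y \<in> X" and l: "Z c x y \<ge> l" for c x y and l :: real
  proof -
    define A where "A = nbhd c x (Y c)"
    define B where "B = nbhd c y (Y c)"
    have Y0: "card (Y c) > 0" using Y by (simp add: card_gt_0_iff)
    have "p c * card (Y c) > 0" using Y0 p by simp
    then have AB0: "card A > 0" "card B > 0"
      using deg[OF xy(1), of c] deg[OF xy(2), of c] unfolding A_def B_def by linarith+
    then have AB: "A \<noteq> {}" "B \<noteq> {}" by auto
    have "A \<subseteq> Y c" "B \<subseteq> Y c" by (auto simp: A_def B_def nbhd_def)
    from sum_indicator_correlation[OF Y(1) this AB]
    have "Z c x y = (p c * card (Y c) / \<alpha> c) * (real (card (A \<inter> B)) / (real (card A) * real (card B)) - 1 / card (Y c))"
      by (simp add: Z_def f_def A_def B_def)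
    then have *: "(p c * card (Y c) / \<alpha> c) * (real (card (A \<inter> B)) / (real (card A) * real (card B)) - 1 / card (Y c)) \<ge> l"
      using l by simp
    have main: "p c * card (Y c) * card (A \<inter> B) \<ge> (p c + l * \<alpha> c) * (real (card A) * real (card B))"
    proof -
      note *
      also have "(p c * card (Y c) / \<alpha> c) * (real (card (A \<inter> B)) / (real (card A) * real (card B)) - 1 / card (Y c))
        = (p c * card (Y c) * card (A \<inter> B) - p c * (real (card A) * real (card B)))
          / (\<alpha> c * (real (card A) * real (card B)))"
        using Y0 AB0 a[of c] by (simp add: field_simps)
      finally have "l * (\<alpha> c * (real (card A) * real (card B)))
          \<le> p c * card (Y c) * card (A \<inter> B) - p c * (real (card A) * real (card B))"
        using AB0 a[of c] by (subst (asm) pos_le_divide_eq) auto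
      then show ?thesis by (simp add: algebra_simps)
    qed
    have int: "nbhd c y (nbhd c x (Y c)) = A \<inter> B" by (auto simp: A_def B_def nbhd_def)
    show ?thesis
    proof (cases "p c + l * \<alpha> c \<ge> 0")
      case True
      have "(p c + l * \<alpha> c) * (real (card A) * (p c * card (Y c))) \<le> (p c + l * \<alpha> c) * (real (card A) * real (card B))"
        using True deg[OF xy(2), of c] by (intro mult_left_mono) (auto simp: B_def)
      also have "\<dots> \<le> p c * card (Y c) * card (A \<inter> B)" by (rule main)
      finally have "(p c * card (Y c)) * ((p c + l * \<alpha> c) * card A) \<le> (p c * card (Y c)) * card (A \<inter> B)"
        by (simp add: mult_ac)
      then have "(p c + l * \<alpha> c) * card A \<le> card (A \<inter> B)"
        by (subst (asm) mult_le_cancel_left_pos) (use \<open>p c * card (Y c) > 0\<close> in auto)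
      then show ?thesis by (simp add: int A_def)
    next
      case False
      then have "(p c + l * \<alpha> c) * card (nbhd c x (Y c)) \<le> 0"
        by (intro mult_nonpos_nonneg) auto
      then show ?thesis by linarith
    qed
  qed
  obtain n c where "real (card {(x, y) \<in> X \<times> X. Z c x y \<ge> level n \<and> Z (\<not> c) x y \<ge> - 6})
    \<ge> exp (- 3 * real n) / 500 * (real (card X))\<^sup>2"
    using gram_pair_correlation[OF X gram] by blast
  from exists_large_section[OF X this]
  obtain x where x: "x \<in> X"
    "real (card {y \<in> X. Z c x y \<ge> level n \<and> Z (\<not> c) x y \<ge> - 6}) \<ge> exp (- 3 * real n) / 500 * card X"
    by blast
  show ?thesis
  proof (intro exI[of _ n] exI[of _ c] bexI[OF _ x(1)] conjI ballI
      exI[of _ "{y \<in> X. Z c x y \<ge> level n \<and> Z (\<not> c) x y \<ge> - 6}"])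
    fix y assume y: "y \<in> {y \<in> X. Z c x y \<ge> level n \<and> Z (\<not> c) x y \<ge> - 6}"
    show "real (card (nbhd c y (nbhd c x (Y c)))) \<ge> (p c + level n * \<alpha> c) * card (nbhd c x (Y c))"
      using y by (intro codeg x) auto
    show "real (card (nbhd (\<not> c) y (nbhd (\<not> c) x (Y (\<not> c)))))
        \<ge> (p (\<not> c) - 6 * \<alpha> (\<not> c)) * card (nbhd (\<not> c) x (Y (\<not> c)))"
      using codeg[of x y "- 6" "\<not> c"] x y by auto
  qed (use x in auto)
qed

end

section \<open>The book algorithm\<close>

context edge_colouring
begin

definition joined :: "bool \<Rightarrow> 'a set \<Rightarrow> 'a set \<Rightarrow> bool" where
  "joined c K Z \<longleftrightarrow> (\<forall>u\<in>K. \<forall>z\<in>Z. C c u z)"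

text \<open>In the notation of the literature \<open>b = p\<^sub>0 - \<delta>\<close> and \<open>q c = p c - p\<^sub>0 + \<delta>\<close>, where \<open>p c\<close> is the
  minimum density from \<open>X\<close> to \<open>Y c\<close>. A colour step multiplies \<open>q c\<close> by \<open>1 - 1/t\<close> and lowers \<open>\<tau> c\<close>,
  which leaves \<open>h c\<close> unchanged; a density-boost step multiplies \<open>h c\<close> by \<open>1 + n\<^sup>2/(6t)\<close>. As
  \<open>h c \<le> 1\<close> throughout, \<open>- ln (h c)\<close> is the remaining budget for boosts.\<close>

lemma book_algorithm:
  fixes A B D \<delta> b m :: real and n0 t :: nat and q :: "bool \<Rightarrow> real" and \<tau> :: "bool \<Rightarrow> nat"
  defines "h \<equiv> \<lambda>q \<tau>. q * (1 - 1 / real t) ^ \<tau>"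
  assumes t: "t \<ge> 2" and b: "b > 0" and \<delta>: "\<delta> > 0" and m: "m > 0"
    and A: "A \<ge> 3 * real n0 + ln 2000" and BD: "B \<ge> 0" "D \<ge> 0"
    and boost: "\<And>n. n > n0 \<Longrightarrow> 1 + (real n)\<^sup>2 / (6 * t) \<le> 4 / \<delta> \<Longrightarrow>
      3 * real n + ln 500 \<le> B * ln (1 + (real n)\<^sup>2 / (6 * t)) \<and> 1 \<le> D * ln (1 + (real n)\<^sup>2 / (6 * t))"
  shows "real (\<tau> True + \<tau> False) - D * (ln (h (q True) (\<tau> True)) + ln (h (q False) (\<tau> False))) \<le> real N \<Longrightarrow>
    finite W \<Longrightarrow> X \<subseteq> W \<Longrightarrow> (\<And>c. Y c \<subseteq> W) \<Longrightarrow> (\<And>c. T c \<subseteq> W) \<Longrightarrow>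
    (\<And>c x. x \<in> X \<Longrightarrow> real (card (nbhd c x (Y c))) \<ge> (b + q c) * card (Y c)) \<Longrightarrow>
    (\<And>c. h (q c) (\<tau> c) \<ge> \<delta> / 4) \<Longrightarrow> (\<And>c. card (T c) + \<tau> c = t) \<Longrightarrow>
    (\<And>c. monochromatic c (T c)) \<Longrightarrow> (\<And>c. joined c (T c) X) \<Longrightarrow> (\<And>c. joined c (T c) (Y c)) \<Longrightarrow>
    real (card X) \<ge> exp (A * (\<tau> True + \<tau> False) - B * (ln (h (q True) (\<tau> True)) + ln (h (q False) (\<tau> False)))) \<Longrightarrow>
    (\<And>c. real (card (Y c)) \<ge> m * exp ((\<tau> c - D * ln (h (q c) (\<tau> c))) * (- ln b))) \<Longrightarrow>
    \<exists>c K Z. K \<subseteq> W \<and> Z \<subseteq> W \<and> monochromatic c K \<and> card K = t \<and> real (card Z) \<ge> m \<and> joined c K Z"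
\<comment> \<open>\<open>N\<close> bounds a potential that falls by at least 1 in every step: a
  colour step lowers one \<open>\<tau>\<close>, and a boost raises \<open>ln h\<close> by at least
  \<open>1 / D\<close>.\<close>
proof (induction N arbitrary: X Y T q \<tau> rule: less_induct)
  case (less N)
  note N = less.prems(1) and finW = less.prems(2) and XW = less.prems(3) and YW = less.prems(4)
    and TW = less.prems(5) and deg = less.prems(6) and h = less.prems(7) and Tcard = less.prems(8)
    and Tm = less.prems(9) and TX = less.prems(10) and TY = less.prems(11)
    and Xl = less.prems(12) and Yl = less.prems(13)
  have \<theta>: "0 < 1 - 1 / real t" "1 - 1 / real t \<le> 1" using t by auto
  have h0: "h (q c) (\<tau> c) > 0" for c using h[of c] \<delta> by simp
  have q0: "q c > 0" for c using h0[of c] \<theta> by (simp add: h_def zero_less_mult_iff)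
  have finX: "finite X" and finY: "\<And>c. finite (Y c)"
    using finW XW YW finite_subset by blast+
  have "real (card X) > 0" by (rule less_le_trans[OF _ Xl]) simp
  then have X0: "X \<noteq> {}" by auto
  have "real (card (Y c)) > 0" for c by (rule less_le_trans[OF _ Yl]) (use m in simp)
  then have Y0: "Y c \<noteq> {}" for c by (metis card.empty less_irrefl of_nat_0)
  \<comment> \<open>A density is at most 1, so \<open>h \<le> q \<le> 1\<close> and the logarithms
    below are nonpositive.\<close>
  have bq: "b + q c \<le> 1" for c
  proof -
    obtain x where x: "x \<in> X" using X0 by blast
    have "(b + q c) * card (Y c) \<le> 1 * real (card (Y c))"
      using deg[OF x, of c] card_mono[OF finY[of c] nbhd_subset[of c x "Y c"]] by simp
    then show ?thesis using Y0 finY by (simp add: mult_le_cancel_right card_gt_0_iff)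
  qed
  have hle: "h (q c) (\<tau> c) \<le> q c" for c
    using \<theta> q0[of c] power_le_one[of "1 - 1 / real t" "\<tau> c"] by (simp add: h_def mult_left_le)
  then have lh: "ln (h (q c) (\<tau> c)) \<le> 0" for c
  proof -
    have "h (q c) (\<tau> c) \<le> 1" using bq[of c] b hle[of c] by linarith
    then show ?thesis using h0[of c] by simp
  qed
  have lb: "- ln b \<ge> 0" using bq[of True] q0[of True] b by simp
  \<comment> \<open>Once \<open>\<tau> c = 0\<close>, the spine is \<open>T c\<close> and the pages
    are \<open>Y c\<close>.\<close>
  have fin: "\<exists>c K Z. K \<subseteq> W \<and> Z \<subseteq> W \<and> monochromatic c K \<and> card K = t \<and> real (card Z) \<ge> m \<and> joined c K Z"
    if "\<tau> c = 0" for c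
  proof (intro exI conjI)
    have "0 \<le> (\<tau> c - D * ln (h (q c) (\<tau> c))) * (- ln b)"
      using lb lh[of c] BD that by (intro mult_nonneg_nonneg) (auto simp: mult_nonneg_nonpos)
    then have "m * 1 \<le> m * exp ((\<tau> c - D * ln (h (q c) (\<tau> c))) * (- ln b))"
      using m by (intro mult_left_mono) auto
    then show "m \<le> real (card (Y c))" using Yl[of c] by linarith
    show "card (T c) = t" using Tcard[of c] that by simp
  qed (use TW YW Tm TY in auto)
  show ?case
  proof (cases "\<exists>c. \<tau> c = 0")
    case True
    then show ?thesis using fin by blast
  next
    case False
    then have \<tau>1: "\<tau> c \<ge> 1" for c by (simp add: Suc_leI)
    have Dle: "D * (ln (h (q True) (\<tau> True)) + ln (h (q False) (\<tau> False))) \<le> 0"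
      using lh[of True] lh[of False] BD by (intro mult_nonneg_nonpos) auto
    have Ble: "B * (ln (h (q True) (\<tau> True)) + ln (h (q False) (\<tau> False))) \<le> 0"
      using lh[of True] lh[of False] BD by (intro mult_nonneg_nonpos) auto
    have "real N \<ge> 1" using N \<tau>1[of True] \<tau>1[of False] Dle by linarith
    then have N1: "N - 1 < N" "real (N - 1) = real N - 1" by (auto simp: of_nat_diff)
    \<comment> \<open>With this unit a loss of \<open>6 * \<alpha> c\<close> is exactly
      \<open>q c / t\<close>, the decrease allowed in a colour step.\<close>
    define \<alpha> where "\<alpha> c = q c / (6 * t)" for c
    have 1: "b + q c > 0" "\<alpha> c > 0" for c using b q0[of c] t by (auto simp: \<alpha>_def)
    obtain n c x X' where x: "x \<in> X" and X': "X' \<subseteq> X" "real (card X') \<ge> exp (- 3 * real n) / 500 * card X"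
      and up: "\<And>y. y \<in> X' \<Longrightarrow> real (card (nbhd c y (nbhd c x (Y c)))) \<ge> (b + q c + level n * \<alpha> c) * card (nbhd c x (Y c))"
      and low: "\<And>y. y \<in> X' \<Longrightarrow> real (card (nbhd (\<not> c) y (nbhd (\<not> c) x (Y (\<not> c)))))
        \<ge> (b + q (\<not> c) - 6 * \<alpha> (\<not> c)) * card (nbhd (\<not> c) x (Y (\<not> c)))"
      using codegree_step[of X Y "\<lambda>c. b + q c" \<alpha>, OF finX X0 finY Y0 1 deg] by metis
    have Ycut: "real (card (nbhd d x (Y d))) \<ge> b * card (Y d)" for d
    proof (rule order_trans[OF _ deg[OF x]])
      show "b * card (Y d) \<le> (b + q d) * card (Y d)"
        using q0[of d] by (intro mult_right_mono) auto
    qed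
    have xW: "x \<in> W" using x XW by blast
    have finX': "finite X'" using X' finX finite_subset by blast
    show ?thesis
    proof (cases "n \<le> n0")
      \<comment> \<open>Colour step: \<open>x\<close> joins a spine. The factor
        \<open>exp (- 3 * n) / 500\<close> for \<open>X'\<close> and a further 1/4 for passing to a
        majority colour are both covered by \<open>exp (- A)\<close>; hence 2000 in the bound on
        \<open>A\<close>.\<close>
      case True
      let ?s = "A * (\<tau> True + \<tau> False - 1) - B * (ln (h (q True) (\<tau> True)) + ln (h (q False) (\<tau> False)))"
      have "4 * exp ?s = 4 * exp (- A) * exp (A * (\<tau> True + \<tau> False) - B * (ln (h (q True) (\<tau> True)) + ln (h (q False) (\<tau> False))))"
        using \<tau>1[of True] by (simp add: mult_exp_exp of_nat_diff algebra_simps)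
      also have "\<dots> \<le> 4 * exp (- A) * card X"
        using Xl by (intro mult_left_mono) auto
      also have "4 * exp (- A) \<le> 4 * exp (- (3 * real n + ln 2000))"
        using A True by simp
      also have "\<dots> = exp (- 3 * real n) / 500"
        by (simp add: exp_diff exp_minus field_simps)
      finally have X'4: "4 * exp ?s \<le> card X'" using X'(2) by (simp add: mult_right_mono)
      have "0 \<le> ?s" using Ble \<tau>1[of True] A by (smt (verit) ln_ge_zero mult_nonneg_nonneg of_nat_0_le_iff)
      then have "4 * 1 \<le> 4 * exp ?s" by simp
      \<comment> \<open>With at least 4 vertices, the possible loss of \<open>x\<close> itself still
        leaves a quarter of \<open>X'\<close> in one colour.\<close>
      then have "real (card X') \<ge> 4" using X'4 by linarith
      moreover have "real (card X') \<le> real (card (nbhd True x X')) + real (card (nbhd False x X')) + 1"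
        using card_nbhd_add[OF finX', of True x] by simp
      ultimately have "real (card X') \<le> 4 * card (nbhd True x X') \<or> real (card X') \<le> 4 * card (nbhd False x X')"
        by linarith
      then obtain j where "real (card X') \<le> 4 * card (nbhd j x X')" by blast
      with X'4 have X'': "real (card (nbhd j x X')) \<ge> exp ?s" by linarith
      define q' where "q' = q(j := (1 - 1 / t) * q j)"
      define \<tau>' where "\<tau>' = \<tau>(j := \<tau> j - 1)"
      define Y' where "Y' = Y(j := nbhd j x (Y j))"
      define T' where "T' = T(j := insert x (T j))"
      have h': "h (q' d) (\<tau>' d) = h (q d) (\<tau> d)" for d
      proof -
        obtain k where "\<tau> j = Suc k" using \<tau>1[of j] by (metis Suc_le_D One_nat_def)
        then show ?thesis by (simp add: q'_def \<tau>'_def h_def)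
      qed
      have \<tau>': "\<tau>' True + \<tau>' False = \<tau> True + \<tau> False - 1"
        using \<tau>1[of True] \<tau>1[of False] by (cases j) (simp_all add: \<tau>'_def)
      have xT: "x \<notin> T j" using TX[of j] x irrefl by (auto simp: joined_def)
      have finT: "finite (T d)" for d using TW finW finite_subset by blast
      have xY: "joined j {x} (nbhd j x (Y j))" by (auto simp: joined_def nbhd_def)
      show ?thesis
      proof (rule less.IH[OF N1(1), where q = q' and \<tau> = \<tau>' and X = "nbhd j x X'" and Y = Y' and T = T'])
        show "real (\<tau>' True + \<tau>' False) - D * (ln (h (q' True) (\<tau>' True)) + ln (h (q' False) (\<tau>' False))) \<le> real (N - 1)"
          unfolding h' \<tau>' N1(2) using N \<tau>1[of True] by (simp add: of_nat_diff)
        show "finite W" by (rule finW)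
        show "nbhd j x X' \<subseteq> W" using X' XW by (auto simp: nbhd_def)
        show "Y' d \<subseteq> W" for d using YW[of d] by (auto simp: Y'_def nbhd_def)
        show "T' d \<subseteq> W" for d using TW[of d] xW by (auto simp: T'_def)
        show "(b + q' d) * card (Y' d) \<le> card (nbhd d y (Y' d))" if y: "y \<in> nbhd j x X'" for d y
        proof (cases "d = j")
          case dj: True
          have yX: "y \<in> X'" using y by (simp add: nbhd_def)
          have q6: "b + q' j = b + q j - 6 * \<alpha> j" using t by (simp add: q'_def \<alpha>_def field_simps)
          show ?thesis
          \<comment> \<open>The majority colour \<open>j\<close> need not be the favoured colour
            \<open>c\<close>, but either way its density falls by at most
            \<open>6 * \<alpha> j\<close>.\<close>
          proof (cases "j = c")
            case True
            have "level n \<ge> - 6" by (simp add: level_def order_trans[OF _ zero_le_power2])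
            then have "- 6 * \<alpha> c \<le> level n * \<alpha> c" using 1(2)[of c] by (intro mult_right_mono) auto
            then have "b + q' j \<le> b + q c + level n * \<alpha> c" using q6 unfolding True by linarith
            then have "(b + q' j) * card (nbhd c x (Y c)) \<le> (b + q c + level n * \<alpha> c) * card (nbhd c x (Y c))"
              by (intro mult_right_mono) auto
            also have "\<dots> \<le> card (nbhd c y (nbhd c x (Y c)))" by (rule up[OF yX])
            finally show ?thesis unfolding dj True Y'_def by simp
          next
            case False
            then have "j = (\<not> c)" by auto
            with low[OF yX] show ?thesis unfolding dj q6 Y'_def by simp
          qed
        next
          case False
          have "y \<in> X" using y X' by (auto simp: nbhd_def)
          then show ?thesis using deg False by (simp add: Y'_def q'_def)
        qed
        show "\<delta> / 4 \<le> h (q' d) (\<tau>' d)" for d unfolding h' by (rule h)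
        show "card (T' d) + \<tau>' d = t" for d
          using Tcard[of d] \<tau>1[of j] xT finT by (auto simp: T'_def \<tau>'_def)
        show "monochromatic d (T' d)" for d
          using Tm TX[of j] x sym by (auto simp: T'_def joined_def intro!: monochromatic_insert)
        show "joined d (T' d) (nbhd j x X')" for d
          using TX[of d] X' by (auto simp: T'_def joined_def nbhd_def)
        show "joined d (T' d) (Y' d)" for d
          using TY[of d] by (auto simp: T'_def Y'_def joined_def nbhd_def)
        show "exp (A * real (\<tau>' True + \<tau>' False) - B * (ln (h (q' True) (\<tau>' True)) + ln (h (q' False) (\<tau>' False))))
            \<le> card (nbhd j x X')"
          unfolding h' \<tau>' by (rule X'')
        show "m * exp ((real (\<tau>' d) - D * ln (h (q' d) (\<tau>' d))) * - ln b) \<le> card (Y' d)" for d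
        proof (cases "d = j")
          case True
          have "m * exp ((real (\<tau>' d) - D * ln (h (q' d) (\<tau>' d))) * - ln b)
            = b * (m * exp ((real (\<tau> d) - D * ln (h (q d) (\<tau> d))) * - ln b))"
            unfolding h' using True b \<tau>1[of j]
            by (simp add: \<tau>'_def of_nat_diff algebra_simps exp_add exp_diff exp_minus)
          also have "\<dots> \<le> b * card (Y d)" using Yl[of d] b by (intro mult_left_mono) auto
          also have "\<dots> \<le> card (Y' d)" using Ycut[of d] True by (simp add: Y'_def)
          finally show ?thesis .
        next
          case False
          then show ?thesis unfolding h' using Yl[of d] by (simp add: \<tau>'_def Y'_def)
        qed
      qed
    next
      \<comment> \<open>Boost step: the spines stay as they are, and replacing \<open>Y c\<close> by
        the neighbourhood of \<open>x\<close> multiplies \<open>q c\<close> by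
        \<open>1 + z\<close>.\<close>
      case False
      define z where "z = (real n)\<^sup>2 / (6 * t)"
      have z0: "z > 0" using False t by (simp add: z_def)
      define q' where "q' = q(c := q c * (1 + z))"
      define Y' where "Y' = Y(c := nbhd c x (Y c))"
      have lev: "b + q c + level n * \<alpha> c = b + q c * (1 + z)"
        using False by (simp add: level_def \<alpha>_def z_def algebra_simps)
      have h': "h (q' d) (\<tau> d) = h (q d) (\<tau> d) * (if d = c then 1 + z else 1)" for d
        by (simp add: q'_def h_def)
      have lnh': "ln (h (q' d) (\<tau> d)) = ln (h (q d) (\<tau> d)) + (if d = c then ln (1 + z) else 0)" for d
        unfolding h' using h0[of d] z0 by (simp add: ln_mult)
      have lnsum: "ln (h (q' True) (\<tau> True)) + ln (h (q' False) (\<tau> False))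
          = ln (h (q True) (\<tau> True)) + ln (h (q False) (\<tau> False)) + ln (1 + z)"
        by (cases c) (simp_all add: lnh')
      have "exp (- 3 * real n) / 500 * card X > 0" using X0 finX by (simp add: card_gt_0_iff)
      then have "X' \<noteq> {}" using X'(2) by auto
      then obtain y where y: "y \<in> X'" by blast
      have "b * card (Y c) > 0" using b Y0[of c] finY by (simp add: card_gt_0_iff)
      then have nb0: "real (card (nbhd c x (Y c))) > 0" using Ycut[of c] by linarith
      have "(b + q c * (1 + z)) * card (nbhd c x (Y c)) \<le> card (nbhd c y (nbhd c x (Y c)))"
        using up[OF y] unfolding lev by simp
      also have "\<dots> \<le> 1 * real (card (nbhd c x (Y c)))"
        using card_mono[OF finite_nbhd[OF finY] nbhd_subset] by simp
      \<comment> \<open>The new density is still at most 1, which caps \<open>z\<close> and places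
        \<open>n\<close> in the range of the hypothesis \<open>boost\<close>.\<close>
      finally have "b + q c * (1 + z) \<le> 1" using nb0 by (subst (asm) mult_le_cancel_right_pos)
      moreover have "\<delta> / 4 * (1 + z) \<le> q c * (1 + z)"
        using h[of c] hle[of c] z0 by (intro mult_right_mono) auto
      ultimately have "\<delta> / 4 * (1 + z) \<le> 1" using b by linarith
      then have "1 + z \<le> 4 / \<delta>" using \<delta> by (simp add: field_simps)
      with boost[of n] False have g: "3 * real n + ln 500 \<le> B * ln (1 + z)" "1 \<le> D * ln (1 + z)"
        by (auto simp: z_def)
      show ?thesis
      proof (rule less.IH[OF N1(1), where q = q' and \<tau> = \<tau> and X = X' and Y = Y' and T = T])
        show "real (\<tau> True + \<tau> False) - D * (ln (h (q' True) (\<tau> True)) + ln (h (q' False) (\<tau> False))) \<le> real (N - 1)"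
          unfolding lnsum N1(2) using N g(2) by (simp add: algebra_simps)
        show "finite W" by (rule finW)
        show "X' \<subseteq> W" using X' XW by auto
        show "Y' d \<subseteq> W" for d using YW[of d] by (auto simp: Y'_def nbhd_def)
        show "T d \<subseteq> W" for d using TW .
        show "(b + q' d) * card (Y' d) \<le> card (nbhd d y (Y' d))" if y: "y \<in> X'" for d y
        proof (cases "d = c")
          case True
          then show ?thesis using up[OF y] unfolding lev by (simp add: Y'_def q'_def)
        next
          case False
          have "y \<in> X" using y X' by auto
          then show ?thesis using deg False by (simp add: Y'_def q'_def)
        qed
        show "\<delta> / 4 \<le> h (q' d) (\<tau> d)" for d
        proof -
          have "h (q d) (\<tau> d) * 1 \<le> h (q' d) (\<tau> d)"
            unfolding h' using h0[of d] z0 by (intro mult_left_mono) auto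
          then show ?thesis using h[of d] by linarith
        qed
        show "card (T d) + \<tau> d = t" for d by (rule Tcard)
        show "monochromatic d (T d)" for d by (rule Tm)
        show "joined d (T d) X'" for d
          using TX[of d] X' by (auto simp: joined_def)
        show "joined d (T d) (Y' d)" for d
          using TY[of d] by (auto simp: Y'_def joined_def nbhd_def)
        show "exp (A * real (\<tau> True + \<tau> False) - B * (ln (h (q' True) (\<tau> True)) + ln (h (q' False) (\<tau> False))))
            \<le> card X'" (is "exp ?s' \<le> _")
        proof -
          have "exp ?s' \<le> exp (- 3 * real n - ln 500 + (A * real (\<tau> True + \<tau> False) - B * (ln (h (q True) (\<tau> True)) + ln (h (q False) (\<tau> False)))))"
            unfolding lnsum using g(1) by (simp add: algebra_simps)
          also have "\<dots> = exp (- 3 * real n) / 500 * exp (A * real (\<tau> True + \<tau> False) - B * (ln (h (q True) (\<tau> True)) + ln (h (q False) (\<tau> False))))"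
            by (simp only: exp_add exp_diff) simp
          also have "\<dots> \<le> exp (- 3 * real n) / 500 * card X"
            using Xl by (intro mult_left_mono) auto
          also have "\<dots> \<le> card X'" by (rule X'(2))
          finally show ?thesis .
        qed
        show "m * exp ((real (\<tau> d) - D * ln (h (q' d) (\<tau> d))) * - ln b) \<le> card (Y' d)" for d
        proof (cases "d = c")
          case True
          \<comment> \<open>Restricting \<open>Y c\<close> costs a factor \<open>b\<close>; the gain
            of at least 1 in \<open>D * ln h\<close> pays for it, as the lowering of
            \<open>\<tau>\<close> does in a colour step.\<close>
          have "(real (\<tau> d) - D * ln (h (q' d) (\<tau> d))) * - ln b \<le> (real (\<tau> d) - D * ln (h (q d) (\<tau> d)) - 1) * - ln b"
            using lb g(2) True by (intro mult_right_mono) (auto simp: lnh' algebra_simps)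
          then have "m * exp ((real (\<tau> d) - D * ln (h (q' d) (\<tau> d))) * - ln b)
            \<le> m * exp ((real (\<tau> d) - D * ln (h (q d) (\<tau> d)) - 1) * - ln b)" using m by simp
          also have "\<dots> = b * (m * exp ((real (\<tau> d) - D * ln (h (q d) (\<tau> d))) * - ln b))"
            using b by (simp add: algebra_simps exp_add exp_diff exp_minus)
          also have "\<dots> \<le> b * card (Y d)" using Yl[of d] b by (intro mult_left_mono) auto
          also have "\<dots> \<le> card (Y' d)" using Ycut[of d] True by (simp add: Y'_def)
          finally show ?thesis .
        next
          case False
          then show ?thesis using Yl[of d] by (simp add: lnh' Y'_def)
        qed
      qed
    qed
  qed
qed

end

section \<open>Existence of large books\<close>

lemma binomial_le_weighted:
  fixes x y :: real
  assumes "x > 0" "y > 0" "x + y = 1"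
  shows "real ((a + b) choose a) \<le> (1 / x) ^ a * (1 / y) ^ b"
proof -
  \<comment> \<open>A single term of the binomial expansion of (x + y)^(a + b) = 1.\<close>
  have "real ((a + b) choose a) * x ^ a * y ^ (a + b - a) \<le> (\<Sum>k\<le>a + b. real ((a + b) choose k) * x ^ k * y ^ (a + b - k))"
    using assms by (intro member_le_sum) auto
  also have "\<dots> = 1" using assms binomial_ring[of x y "a + b"] by simp
  finally show ?thesis using assms by (simp add: field_simps)
qed

lemma one_minus_inverse_power_ge:
  fixes t :: nat
  assumes "t \<ge> 10"
  shows "1 / 4 \<le> (1 - 1 / real t) ^ t"
proof -
  have x: "0 \<le> 1 / real t" "1 / real t \<le> 1 / 2" "1 / real t \<le> 1 / 10"
    using assms by (auto simp: field_simps)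
  have "1 - 1 / (5::real) \<le> exp (- (1 / 5))" using exp_ge_add_one_self[of "- (1/5) :: real"] by simp
  then have "exp (1 / 5 :: real) \<le> 5 / 4" by (simp add: exp_minus field_simps)
  moreover have "exp (1::real) \<le> 3" by (rule exp_le)
  ultimately have "exp 1 * exp (1 / 5 :: real) \<le> 3 * (5 / 4)" by (intro mult_mono) auto
  then have "exp (6 / 5 :: real) \<le> 4" by (simp add: mult_exp_exp)
  then have "1 / 4 \<le> exp (- (6 / 5) :: real)" by (simp add: exp_minus field_simps)
  also have "\<dots> \<le> exp (real t * ln (1 - 1 / real t))"
  proof -
    have "- (6 / 5) \<le> real t * (- (1 / real t) - 2 * (1 / real t)\<^sup>2)"
      using assms by (simp add: field_simps power2_eq_square)
    also have "\<dots> \<le> real t * ln (1 - 1 / real t)"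
      using ln_one_minus_pos_lower_bound[OF x(1,2)] by (intro mult_left_mono) auto
    finally show ?thesis by simp
  qed
  also have "\<dots> = (1 - 1 / real t) ^ t"
    using assms by (simp add: exp_of_nat_mult)
  finally show ?thesis .
qed

lemma ln_one_plus_ge_half:
  fixes x :: real
  assumes "0 \<le> x" "x \<le> 1"
  shows "x / 2 \<le> ln (1 + x)"
proof -
  have "- ln (1 + x) \<le> 1 / (1 + x) - 1"
    using ln_le_minus_one[of "1 / (1 + x)"] assms by (simp add: ln_div)
  also have "\<dots> = - (x / (1 + x))" using assms by (simp add: field_simps)
  finally have "x / (1 + x) \<le> ln (1 + x)" by simp
  moreover have "x / 2 \<le> x / (1 + x)" using assms by (intro divide_left_mono) auto
  ultimately show ?thesis by linarith
qed

lemma ln_one_minus_ge: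
  fixes x :: real
  assumes "0 \<le> x" "x \<le> 1 / 2"
  shows "- 2 * x \<le> ln (1 - x)"
proof -
  have "2 * x\<^sup>2 \<le> x" using assms mult_left_mono[of x "1/2" x] by (simp add: power2_eq_square)
  then show ?thesis using ln_one_minus_pos_lower_bound[OF assms] by linarith
qed

text \<open>As 5/2 \<le> e, numerical bounds on logarithms reduce to rational powers.\<close>

lemma ln_le_of_nat:
  fixes x :: real
  assumes "0 < x" "x \<le> (5 / 2) ^ n"
  shows "ln x \<le> real n"
proof -
  have "(5 / 2 :: real) ^ n \<le> exp 1 ^ n"
    using exp_lower_Taylor_quadratic[of "1::real"] by (intro power_mono) auto
  also have "\<dots> = exp (real n)" using exp_of_nat_mult[of n "1::real"] by simp
  finally have "x \<le> exp (real n)" using assms by linarith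
  then show ?thesis using assms by (metis ln_exp ln_le_cancel_iff exp_gt_zero)
qed

context edge_colouring
begin

text \<open>The algorithm starts from \<open>X = Y c = W\<close> with empty spines,
  \<open>\<tau> c = t\<close> and \<open>q c = \<delta>\<close>. Then \<open>h\<close> is at least
  \<open>\<delta> / 4\<close>, so the boost budget of each colour is at most
  \<open>ln (4 / \<delta>)\<close>.\<close>

lemma exists_book:
  fixes A B D \<delta> b m :: real and n0 t :: nat
  assumes t: "t \<ge> 10" and b: "b > 0" "b \<le> 1" and \<delta>: "\<delta> > 0" "\<delta> \<le> 1" and m: "m > 0"
    and A: "A \<ge> 3 * real n0 + ln 2000" and BD: "B \<ge> 0" "D \<ge> 0"
    and boost: "\<And>n. n > n0 \<Longrightarrow> 1 + (real n)\<^sup>2 / (6 * t) \<le> 4 / \<delta> \<Longrightarrow>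
      3 * real n + ln 500 \<le> B * ln (1 + (real n)\<^sup>2 / (6 * t)) \<and> 1 \<le> D * ln (1 + (real n)\<^sup>2 / (6 * t))"
    and W: "finite W" and deg: "\<And>c x. x \<in> W \<Longrightarrow> real (card (nbhd c x W)) \<ge> (b + \<delta>) * card W"
    and large: "real (card W) \<ge> exp (2 * A * t + 2 * B * ln (4 / \<delta>))"
      "real (card W) \<ge> m * exp ((t + D * ln (4 / \<delta>)) * (- ln b))"
  shows "\<exists>c K Z. K \<subseteq> W \<and> Z \<subseteq> W \<and> monochromatic c K \<and> card K = t \<and> real (card Z) \<ge> m \<and> joined c K Z"
proof -
  define \<theta> where "\<theta> = (1 - 1 / real t) ^ t"
  have "\<delta> * (1 / 4) \<le> \<delta> * \<theta>"
    using one_minus_inverse_power_ge[OF t] \<delta> unfolding \<theta>_def by (intro mult_left_mono) auto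
  then have h4: "\<delta> / 4 \<le> \<delta> * \<theta>" by simp
  have "ln (\<delta> / 4) \<le> ln (\<delta> * \<theta>)" using h4 \<delta> by simp
  then have l: "- ln (\<delta> * \<theta>) \<le> ln (4 / \<delta>)" using \<delta> by (simp add: ln_div)
  obtain N where N: "real (t + t) - D * (ln (\<delta> * \<theta>) + ln (\<delta> * \<theta>)) \<le> real N"
    using real_arch_simple by blast
  have "A * real (t + t) - B * (ln (\<delta> * \<theta>) + ln (\<delta> * \<theta>)) \<le> 2 * A * t + 2 * B * ln (4 / \<delta>)"
    using mult_left_mono[OF l BD(1)] by (simp add: algebra_simps)
  then have 1: "exp (A * real (t + t) - B * (ln (\<delta> * \<theta>) + ln (\<delta> * \<theta>))) \<le> card W"
    using large(1) order_trans exp_le_cancel_iff by metis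
  have "t - D * ln (\<delta> * \<theta>) \<le> t + D * ln (4 / \<delta>)"
    using mult_left_mono[OF l BD(2)] by (simp add: algebra_simps)
  then have "(t - D * ln (\<delta> * \<theta>)) * (- ln b) \<le> (t + D * ln (4 / \<delta>)) * (- ln b)"
    using b by (intro mult_right_mono) auto
  then have "m * exp ((t - D * ln (\<delta> * \<theta>)) * (- ln b)) \<le> m * exp ((t + D * ln (4 / \<delta>)) * (- ln b))"
    using m by simp
  then have 2: "m * exp ((t - D * ln (\<delta> * \<theta>)) * (- ln b)) \<le> card W"
    using large(2) by linarith
  show ?thesis
    by (rule book_algorithm[of t b \<delta> m n0 A B D "\<lambda>_. t" "\<lambda>_. \<delta>" N W W "\<lambda>_. W" "\<lambda>_. {}"])
      (use t b \<delta> m A BD boost W deg N 1 2 h4 in \<open>simp_all add: \<theta>_def monochromatic_def joined_def\<close>)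
qed

section \<open>Maximal pairs of cliques over a common neighbourhood\<close>

lemma monochromatic_Un:
  assumes "monochromatic c S" "monochromatic c K" "joined c S K"
  shows "monochromatic c (S \<union> K)" "S \<inter> K = {}"
proof -
  show "monochromatic c (S \<union> K)"
    using assms by (auto simp: monochromatic_def joined_def intro: sym)
  show "S \<inter> K = {}"
    using assms(3) irrefl by (auto simp: joined_def)
qed

text \<open>Choose the total clique size maximal, subject to a common neighbourhood that keeps a
  factor \<open>r\<close> per clique vertex. A vertex of \<open>W\<close> with degree at least
  \<open>r * card W\<close> in some colour would extend the pair.\<close>

lemma regular_core:
  fixes r :: real
  assumes V: "finite V" "V \<noteq> {}" and r: "r > 0"
  obtains S W where "W \<subseteq> V" "\<And>c. S c \<subseteq> V" "\<And>c. monochromatic c (S c)" "\<And>c. joined c (S c) W"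
    "real (card W) \<ge> r ^ (card (S True) + card (S False)) * card V"
    "\<And>c x. x \<in> W \<Longrightarrow> real (card (nbhd c x W)) < r * card W"
proof -
  define P where "P s \<longleftrightarrow> (\<exists>S W. W \<subseteq> V \<and> (\<forall>c. S c \<subseteq> V \<and> monochromatic c (S c) \<and> joined c (S c) W) \<and>
    real (card W) \<ge> r ^ s * card V \<and> s = card (S True) + card (S False))" for s
  have "P 0" unfolding P_def
    by (rule exI[of _ "\<lambda>_. {}"], rule exI[of _ V]) (auto simp: monochromatic_def joined_def)
  moreover have "s \<le> 2 * card V" if "P s" for s
    using that V card_mono unfolding P_def by (metis add_mono mult_2)
  ultimately obtain s where s: "P s" "\<And>s'. P s' \<Longrightarrow> s' \<le> s"
    by (metis GreatestI_nat Greatest_le_nat)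
  then obtain S W where W: "W \<subseteq> V" "\<And>c. S c \<subseteq> V" "\<And>c. monochromatic c (S c)" "\<And>c. joined c (S c) W"
    "real (card W) \<ge> r ^ s * card V" "s = card (S True) + card (S False)"
    unfolding P_def by blast
  have deg: "real (card (nbhd c x W)) < r * card W" if x: "x \<in> W" for c x
  proof (rule ccontr)
    assume "\<not> ?thesis"
    then have "real (card (nbhd c x W)) \<ge> r * (r ^ s * card V)"
      using W(5) r mult_left_mono[OF W(5), of r] by linarith
    then have card: "real (card (nbhd c x W)) \<ge> r ^ Suc s * card V" by simp
    define S' where "S' = S(c := insert x (S c))"
    have "x \<notin> S c" using W(4)[of c] x irrefl by (auto simp: joined_def)
    moreover have "finite (S c)" using W(2) V finite_subset by blast
    ultimately have S'card: "Suc s = card (S' True) + card (S' False)"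
      using W(6) by (cases c) (auto simp: S'_def)
    have S': "S' d \<subseteq> V \<and> monochromatic d (S' d) \<and> joined d (S' d) (nbhd c x W)" for d
    proof (cases "d = c")
      case True
      have "monochromatic c (insert x (S c))"
        using W(3,4)[of c] x sym by (intro monochromatic_insert) (auto simp: joined_def)
      then show ?thesis using True W(1,2,4) x by (auto simp: S'_def joined_def nbhd_def)
    next
      case False
      then show ?thesis using W by (auto simp: S'_def joined_def nbhd_def)
    qed
    have "P (Suc s)" unfolding P_def
      using S' S'card card W(1) nbhd_subset by (intro exI[of _ S'] exI[of _ "nbhd c x W"]) (auto dest: nbhd_subset[THEN subsetD])
    then show False using s(2) by fastforce
  qed
  have "real (card W) \<ge> r ^ (card (S True) + card (S False)) * card V"
    using W(5) unfolding W(6) .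
  from that[OF W(1-4) this deg] show thesis .
qed

end

section \<open>The exponential diagonal bound\<close>

lemma boost_cost:
  fixes t :: real
  assumes t: "t \<ge> 10 ^ 26" and n: "n > 7000000" and z: "1 + (real n)\<^sup>2 / (6 * t) \<le> 3276800000000"
  shows "3 * real n + ln 500 \<le> 12 * t * 21000007 / 7000000\<^sup>2 * ln (1 + (real n)\<^sup>2 / (6 * t))"
    and "1 \<le> 12 * t / 7000000\<^sup>2 * ln (1 + (real n)\<^sup>2 / (6 * t))"
proof -
  define z where "z = (real n)\<^sup>2 / (6 * t)"
  have t0: "t > 0" using t by simp
  have z0: "z > 0" using n t0 by (simp add: z_def)
  have l: "ln (500::real) \<le> 7" using ln_le_of_nat[of 500 7] by (simp add: power_divide)
  have nr: "real n \<ge> 7000000" using n by simp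
  have n2: "(real n)\<^sup>2 \<ge> 7000000 * real n" using nr by (simp add: power2_eq_square mult_right_mono)
  have "3 * real n + ln 500 \<le> 12 * t * 21000007 / 7000000\<^sup>2 * ln (1 + z) \<and> 1 \<le> 12 * t / 7000000\<^sup>2 * ln (1 + z)"
  \<comment> \<open>For small \<open>z\<close> the logarithm is at least \<open>z / 2\<close>, and
    \<open>12 * t * (z / 2)\<close> is \<open>n\<close> squared; the constant 21000007 is 3 *
    7000000 + 7 with 7 \<ge> ln 500. For large \<open>z\<close> the cap on \<open>z\<close> forces
    \<open>n \<le> t / 2000000\<close>, while the logarithm is at least 1/2.\<close>
  proof (cases "z \<le> 1")
    case True
    have lz: "z / 2 \<le> ln (1 + z)" using True z0 by (intro ln_one_plus_ge_half) auto
    have tz: "12 * t * (z / 2) = (real n)\<^sup>2" using t0 by (simp add: z_def)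
    have "(real n)\<^sup>2 \<le> 12 * t * ln (1 + z)" unfolding tz[symmetric] using lz t0 by (intro mult_left_mono) auto
    then show ?thesis using n2 nr l by simp
  next
    case False
    have "ln 2 \<le> ln (1 + z)" using False by simp
    then have lz: "1 / 2 \<le> ln (1 + z)" using ln2_ge_two_thirds by linarith
    have "(real n)\<^sup>2 \<le> 20000000000000 * t" using z t0 by (simp add: field_simps)
    also have "\<dots> \<le> (t / 2000000)\<^sup>2"
    proof -
      have "80000000000000000000000000 * t \<le> t * t" using t t0 by (intro mult_right_mono) auto
      then show ?thesis by (simp add: power2_eq_square)
    qed
    finally have "real n \<le> t / 2000000" by (rule power2_le_imp_le) (use t0 in simp)
    moreover define u where "u = t * ln (1 + z)"
    have "t * (1 / 2) \<le> u" unfolding u_def using lz t0 by (intro mult_left_mono) auto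
    ultimately have "3 * real n + ln 500 \<le> 12 * 21000007 / 7000000\<^sup>2 * u \<and> 1 \<le> 12 / 7000000\<^sup>2 * u"
      using l t by simp
    then show ?thesis by (simp add: u_def mult_ac)
  qed
  then show "3 * real n + ln 500 \<le> 12 * t * 21000007 / 7000000\<^sup>2 * ln (1 + (real n)\<^sup>2 / (6 * t))"
    "1 \<le> 12 * t / 7000000\<^sup>2 * ln (1 + (real n)\<^sup>2 / (6 * t))"
    by (auto simp: z_def)
qed

text \<open>Weights \<open>(1 - \<eta>) / 2\<close> and \<open>(1 + \<eta>) / 2\<close> in the
  binomial theorem: the common part of the exponents loses only second order in
  \<open>\<eta>\<close>, and the surplus \<open>d\<close> gains first order.\<close>

lemma binomial_le_skewed:
  fixes \<eta> :: real and a b d :: nat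
  assumes \<eta>: "0 \<le> \<eta>" "\<eta> \<le> 1 / 2" and d: "a + d \<le> b"
  shows "real ((a + b) choose a) \<le> exp (real (a + b) * ln 2 + 2 * \<eta>\<^sup>2 * a - d * \<eta> / 2)"
proof -
  have pos: "0 < (1 - \<eta>) / 2" "0 < (1 + \<eta>) / 2" using \<eta> by auto
  have e2: "\<eta>\<^sup>2 \<le> 1 / 2" using \<eta> power_mono[of \<eta> "1/2" 2] by (simp add: power_divide)
  have "real ((a + b) choose a) \<le> (1 / ((1 - \<eta>) / 2)) ^ a * (1 / ((1 + \<eta>) / 2)) ^ b"
    using pos by (intro binomial_le_weighted) (auto simp: field_simps)
  also have "\<dots> = exp (real a * ln (1 / ((1 - \<eta>) / 2)) + real b * ln (1 / ((1 + \<eta>) / 2)))"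
    using pos by (simp add: exp_add exp_of_nat_mult)
  also have "ln (1 / ((1 - \<eta>) / 2)) = ln 2 - ln (1 - \<eta>)" using \<eta> by (simp add: ln_div)
  also have "ln (1 / ((1 + \<eta>) / 2)) = ln 2 - ln (1 + \<eta>)" using \<eta> by (simp add: ln_div)
  also have "exp (real a * (ln 2 - ln (1 - \<eta>)) + real b * (ln 2 - ln (1 + \<eta>)))
      \<le> exp (real (a + b) * ln 2 + 2 * \<eta>\<^sup>2 * a - d * \<eta> / 2)"
  proof -
    have "1 - \<eta>\<^sup>2 = (1 - \<eta>) * (1 + \<eta>)" by (simp add: power2_eq_square algebra_simps)
    then have "ln (1 - \<eta>\<^sup>2) = ln (1 - \<eta>) + ln (1 + \<eta>)"
      using \<eta> by (simp add: ln_mult)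
    then have "- (2 * \<eta>\<^sup>2) \<le> ln (1 - \<eta>) + ln (1 + \<eta>)"
      using ln_one_minus_ge[of "\<eta>\<^sup>2"] e2 by simp
    then have "real a * (- (2 * \<eta>\<^sup>2)) \<le> real a * (ln (1 - \<eta>) + ln (1 + \<eta>))"
      by (intro mult_left_mono) auto
    moreover have "(real a + d) * ln (1 + \<eta>) \<le> real b * ln (1 + \<eta>)"
      using d \<eta> by (intro mult_right_mono) auto
    moreover have "real d * (\<eta> / 2) \<le> real d * ln (1 + \<eta>)"
      using \<eta> by (intro mult_left_mono ln_one_plus_ge_half) auto
    ultimately show ?thesis by (simp add: algebra_simps)
  qed
  finally show ?thesis .
qed

context edge_colouring
begin

text \<open>Otherwise Erdos-Szekeres inside \<open>Z\<close> gives a clique that, joined to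
  \<open>K1\<close> or \<open>K2\<close>, has more than \<open>k\<close> vertices.\<close>

lemma card_lt_binomial:
  assumes no: "\<forall>c. \<forall>K\<subseteq>V. monochromatic c K \<longrightarrow> card K \<le> k"
    and V: "finite V" "Z \<subseteq> V" "K1 \<subseteq> V" "K2 \<subseteq> V"
    and m: "monochromatic c K1" "monochromatic (\<not> c) K2" and j: "joined c K1 Z" "joined (\<not> c) K2 Z"
  shows "card Z < ((k - card K1) + (k - card K2)) choose (k - card K1)"
proof (rule ccontr)
  have fin: "finite K1" "finite K2" "finite Z" using V finite_subset by blast+
  have contra: False
    if K: "K \<subseteq> Z" "card K = Suc (k - card S)" "monochromatic d K"
      and S: "S \<subseteq> V" "finite S" "monochromatic d S" "joined d S Z" for d K S
  proof -
    have j: "joined d S K" using K S by (auto simp: joined_def)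
    have "card (S \<union> K) = card S + card K"
      using monochromatic_Un(2)[OF S(3) K(3) j] S fin K(1) finite_subset by (intro card_Un_disjoint) auto
    moreover have "card (S \<union> K) \<le> k"
      using no monochromatic_Un(1)[OF S(3) K(3) j] K(1) S(1) V(2) by (metis Un_least subset_trans)
    ultimately show False using K(2) by linarith
  qed
  assume "\<not> ?thesis"
  then have "card Z \<ge> ((k - card K1) + (k - card K2)) choose (k - card K1)" by simp
  from erdos_szekeres[OF fin(3) this, of c] show False
    using contra[of _ K1 c] contra[of _ K2 "\<not> c"] V m j fin by blast
qed

text \<open>The books have a spine of \<open>t = \<lfloor>k / 10^8\<rfloor>\<close> vertices. With \<open>\<epsilon> = 2^-14 / 10^8\<close> and
  \<open>\<eta> = 2^-5 / 10^8\<close> the skewness of the residual Ramsey problem gains a factor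
  \<open>exp (t \<eta> / 4 - 2 \<eta>\<^sup>2 k)\<close>, which beats the losses from \<open>\<epsilon>\<close>, from the boosts and from the
  factor \<open>exp (- k / (2^16 10^16))\<close>.\<close>

lemma diagonal_large:
  fixes k t :: nat
  defines "t \<equiv> k div 100000000"
  assumes t: "real t \<ge> 10 ^ 26" and V: "finite V"
    and large: "real (card V) \<ge> 4 ^ k * exp (- real k / 655360000000000000000)"
  shows "\<exists>c K. K \<subseteq> V \<and> card K = k + 1 \<and> monochromatic c K"
proof (rule ccontr)
  assume neg: "\<not> ?thesis"
  have no: "card K \<le> k" if "K \<subseteq> V" "monochromatic c K" for c K
  proof (rule ccontr)
    assume "\<not> ?thesis"
    then have "k + 1 \<le> card K" by simp
    then obtain K' where "K' \<subseteq> K" "card K' = k + 1" using obtain_subset_with_card_n by metis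
    moreover from this have "monochromatic c K'" using that by (auto simp: monochromatic_def)
    ultimately show False using neg that by blast
  qed
  then have no': "\<forall>c. \<forall>K\<subseteq>V. monochromatic c K \<longrightarrow> card K \<le> k" by blast
  define \<epsilon> :: real where "\<epsilon> = 1 / 1638400000000"
  define \<eta> :: real where "\<eta> = 1 / 3200000000"
  have kt: "100000000 * real t \<le> real k" "real k \<le> 200000000 * real t"
  proof -
    have "100000000 * t \<le> k" by (simp add: t_def)
    then show "100000000 * real t \<le> real k" by linarith
    have "k < 100000000 * t + 100000000"
      using mult_div_mod_eq[of 100000000 k] mod_less_divisor[of 100000000 k] unfolding t_def by linarith
    then have "real k < 100000000 * real t + 100000000" by linarith
    then show "real k \<le> 200000000 * real t" using t by simp
  qed
  have t0: "real t > 0" using t by simp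
  have t10: "t \<ge> 10" using t by simp
  have "0 < 4 ^ k * exp (- real k / 655360000000000000000)" by simp
  then have V0: "real (card V) > 0" using large by linarith
  then have "V \<noteq> {}" by auto
  then obtain S W where WV: "W \<subseteq> V" and SV: "\<And>c. S c \<subseteq> V" and Sm: "\<And>c. monochromatic c (S c)"
    and SW: "\<And>c. joined c (S c) W"
    and Wl: "real (card W) \<ge> (1 / 2 + \<epsilon>) ^ (card (S True) + card (S False)) * card V"
    and Wr: "\<And>c x. x \<in> W \<Longrightarrow> real (card (nbhd c x W)) < (1 / 2 + \<epsilon>) * card W"
    by (rule regular_core[of V "1 / 2 + \<epsilon>", OF V]) (simp add: \<epsilon>_def, blast)
  define s where "s = card (S True) + card (S False)"
  have finW: "finite W" using WV V finite_subset by blast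
  have Sk: "card (S c) \<le> k" for c using no[OF SV Sm] .
  have ssum: "card (S c) + card (S (\<not> c)) = s" for c by (cases c) (auto simp: s_def)
  have s2k: "s \<le> 2 * k" using Sk[of True] Sk[of False] by (simp add: s_def)
  have W0: "real (card W) > 0"
  proof (rule less_le_trans[OF _ Wl])
    show "0 < (1 / 2 + \<epsilon>) ^ (card (S True) + card (S False)) * card V"
      using V0 by (intro mult_pos_pos zero_less_power) (auto simp: \<epsilon>_def)
  qed
  have up: "ln (card W) \<le> (2 * real k - s) * ln 2"
  proof -
    have "card W \<le> ((k - card (S True)) + (k - card (S False))) choose (k - card (S True))"
      using card_lt_binomial[where c = True, OF no' V WV SV[of True] SV[of False]] Sm[of True] Sm[of False] SW[of True] SW[of False]
      by simp
    then have "real (card W) \<le> real (((k - card (S True)) + (k - card (S False))) choose (k - card (S True)))"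
      by linarith
    also have "\<dots> \<le> exp (real ((k - card (S True)) + (k - card (S False))) * ln 2)"
    proof -
      have two: "exp (real n * ln 2) = (2::real) ^ n" for n by (simp only: exp_of_nat_mult) simp
      show ?thesis unfolding two
        using binomial_le_weighted[of "1/2" "1/2" "k - card (S True)" "k - card (S False)"]
        by (simp add: power_add)
    qed
    also have "real ((k - card (S True)) + (k - card (S False))) = 2 * real k - s"
      using Sk[of True] Sk[of False] by (simp add: s_def of_nat_diff)
    finally have "real (card W) \<le> exp ((2 * real k - s) * ln 2)" .
    then have "ln (card W) \<le> ln (exp ((2 * real k - s) * ln 2))" using W0 by (subst ln_le_cancel_iff) auto
    then show ?thesis by simp
  qed
  \<comment> \<open>Each clique vertex keeps a proportion \<open>1/2 + \<epsilon>\<close>, a gain of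
    \<open>\<epsilon>\<close> in the logarithm over the halving that the upper bound
    \<open>up\<close> allows.\<close>
  have low: "ln (card W) \<ge> s * \<epsilon> + (2 * real k - s) * ln 2 - real k / 655360000000000000000"
  proof -
    have "ln ((1 / 2 + \<epsilon>) ^ s * (4 ^ k * exp (- real k / 655360000000000000000))) \<le> ln (card W)"
    proof (subst ln_le_cancel_iff)
      have "(1 / 2 + \<epsilon>) ^ s * (4 ^ k * exp (- real k / 655360000000000000000)) \<le> (1 / 2 + \<epsilon>) ^ s * card V"
        using large by (intro mult_left_mono) (auto simp: \<epsilon>_def)
      then show "(1 / 2 + \<epsilon>) ^ s * (4 ^ k * exp (- real k / 655360000000000000000)) \<le> card W"
        using Wl unfolding s_def by linarith
      show "0 < (1 / 2 + \<epsilon>) ^ s * (4 ^ k * exp (- real k / 655360000000000000000))"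
        by (intro mult_pos_pos zero_less_power) (auto simp: \<epsilon>_def)
    qed (rule W0)
    moreover have "ln ((1 / 2 + \<epsilon>) ^ s * (4 ^ k * exp (- real k / 655360000000000000000)))
        = s * ln (1 / 2 + \<epsilon>) + (k * ln 4 - real k / 655360000000000000000)"
      by (subst ln_mult) (auto simp: \<epsilon>_def ln_mult ln_realpow)
    moreover have "ln 4 = 2 * ln (2::real)" using ln_realpow[of 2 2] by simp
    moreover have "ln (1 / 2 + \<epsilon>) \<ge> \<epsilon> - ln 2"
    proof -
      have "ln (1 / 2 + \<epsilon>) = ln ((1 + 2 * \<epsilon>) / 2)" by (simp add: field_simps)
      also have "\<dots> = ln (1 + 2 * \<epsilon>) - ln 2" by (subst ln_div) (auto simp: \<epsilon>_def)
      finally show ?thesis using ln_one_plus_ge_half[of "2 * \<epsilon>"] by (simp add: \<epsilon>_def)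
    qed
    then have "s * (\<epsilon> - ln 2) \<le> s * ln (1 / 2 + \<epsilon>)" by (intro mult_left_mono) auto
    ultimately show ?thesis by (simp add: algebra_simps)
  qed
  \<comment> \<open>\<open>up\<close> and \<open>low\<close> together bound
    \<open>s * \<epsilon>\<close> by the assumed deficit of \<open>V\<close>: the cliques are short
    compared with the spine.\<close>
  have st: "real s \<le> real t / 2" using up low kt by (simp add: \<epsilon>_def)
  have Wk: "ln (card W) \<ge> real k"
  proof -
    have "(2 * real k - s) * (2 / 3) \<le> (2 * real k - s) * ln 2"
      using s2k ln2_ge_two_thirds by (intro mult_left_mono) auto
    then have "4 / 3 * real k - 2 / 3 * real s \<le> (2 * real k - s) * ln 2" by (simp add: field_simps)
    moreover have "0 \<le> real s * \<epsilon>" by (simp add: \<epsilon>_def)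
    moreover have "real k / 655360000000000000000 \<le> real k / 6" by (simp add: field_simps)
    moreover have "2 / 3 * real s \<le> real k / 6" using st kt t0 by simp
    ultimately show ?thesis using low by linarith
  qed
  have Wbig: "1 \<le> \<epsilon> * card W"
  proof -
    have "real k \<le> card W" using Wk ln_le_minus_one[OF W0] by linarith
    then show ?thesis using kt t by (simp add: \<epsilon>_def)
  qed
  \<comment> \<open>The other colour has degree below \<open>(1/2 + \<epsilon>) * card W\<close>,
    and the vertex itself costs at most \<open>\<epsilon> * card W\<close>; this leaves density
    \<open>1/2 - 2 * \<epsilon>\<close>.\<close>
  have deg: "real (card (nbhd c x W)) \<ge> ((1 / 2 - 4 * \<epsilon>) + 2 * \<epsilon>) * card W" if "x \<in> W" for c x
  proof -
    have "card W \<le> card (nbhd c x W) + card (nbhd (\<not> c) x W) + 1"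
      by (rule card_nbhd_add[OF finW])
    then have "real (card W) \<le> real (card (nbhd c x W)) + real (card (nbhd (\<not> c) x W)) + 1"
      by linarith
    then show ?thesis using Wr[OF that, of "\<not> c"] Wbig by (simp add: algebra_simps)
  qed
  \<comment> \<open>The logarithm of the skewed binomial bound for the problem that remains after
    the book, so \<open>exp M\<close> pages are too many.\<close>
  define M where "M = (2 * real k - s - t) * ln 2 + 2 * \<eta>\<^sup>2 * k - (real t - s) * \<eta> / 2"
  define A where "A = 3 * real 7000000 + 9"
  define B where "B = 12 * real t * 21000007 / 7000000\<^sup>2"
  define D where "D = 12 * real t / 7000000\<^sup>2"
  have A: "A \<ge> 3 * real 7000000 + ln 2000"
    using ln_le_of_nat[of 2000 9] by (simp add: A_def power_divide)
  have l\<epsilon>: "ln (4 / (2 * \<epsilon>)) \<le> 32" "0 \<le> ln (4 / (2 * \<epsilon>))"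
    using ln_le_of_nat[of "4 / (2 * \<epsilon>)" 32] by (simp_all add: \<epsilon>_def power_divide)
  have BD: "B \<ge> 0" "D \<ge> 0" by (auto simp: B_def D_def)
  have lB: "B * ln (4 / (2 * \<epsilon>)) \<le> B * 32" and lD: "D * ln (4 / (2 * \<epsilon>)) \<le> D * 32"
    using l\<epsilon> BD by (auto intro: mult_left_mono)
  have lb: "- ln (1 / 2 - 4 * \<epsilon>) \<le> ln 2 + 16 * \<epsilon>"
  proof -
    have "ln (1 / 2 - 4 * \<epsilon>) = ln ((1 - 8 * \<epsilon>) / 2)" by (simp add: field_simps)
    also have "\<dots> = ln (1 - 8 * \<epsilon>) - ln 2" by (subst ln_div) (auto simp: \<epsilon>_def)
    finally show ?thesis using ln_one_minus_ge[of "8 * \<epsilon>"] by (simp add: \<epsilon>_def)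
  qed
  have "\<exists>c K Z. K \<subseteq> W \<and> Z \<subseteq> W \<and> monochromatic c K \<and> card K = t \<and> real (card Z) \<ge> exp M \<and> joined c K Z"
  proof (rule exists_book[of t "1 / 2 - 4 * \<epsilon>" "2 * \<epsilon>" "exp M" 7000000 A B D W])
    show "3 * real n + ln 500 \<le> B * ln (1 + (real n)\<^sup>2 / real (6 * t)) \<and> 1 \<le> D * ln (1 + (real n)\<^sup>2 / real (6 * t))"
      if "n > 7000000" "1 + (real n)\<^sup>2 / real (6 * t) \<le> 4 / (2 * \<epsilon>)" for n
      using boost_cost[OF t that(1)] that(2) by (simp add: B_def D_def \<epsilon>_def)
    have "2 * A * t + 2 * B * ln (4 / (2 * \<epsilon>)) \<le> ln (card W)"
    proof -
      have "2 * A * t + 2 * (B * 32) \<le> 100000000 * real t" using t0 by (simp add: A_def B_def)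
      then show ?thesis using lB Wk kt by simp
    qed
    then show "exp (2 * A * t + 2 * B * ln (4 / (2 * \<epsilon>))) \<le> card W" using W0 by (simp add: ln_ge_iff)
    have "M + (t + D * ln (4 / (2 * \<epsilon>))) * - ln (1 / 2 - 4 * \<epsilon>) \<le> ln (card W)"
    proof -
      let ?X = "D * ln (4 / (2 * \<epsilon>))"
      have X: "0 \<le> ?X" using BD l\<epsilon> by simp
      have "(t + ?X) * - ln (1 / 2 - 4 * \<epsilon>) \<le> (t + ?X) * (ln 2 + 16 * \<epsilon>)"
        using lb X by (intro mult_left_mono) auto
      also have "\<dots> = t * ln 2 + t * (16 * \<epsilon>) + ?X * (ln 2 + 16 * \<epsilon>)" by (simp add: algebra_simps)
      also have "?X * (ln 2 + 16 * \<epsilon>) \<le> ?X * 1"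
        using X ln2_le_25_over_36 by (intro mult_left_mono) (auto simp: \<epsilon>_def)
      finally have 1: "(t + ?X) * - ln (1 / 2 - 4 * \<epsilon>) \<le> t * ln 2 + t * (16 * \<epsilon>) + D * 32" using lD by simp
      \<comment> \<open>The decisive comparison: as \<open>s \<le> t / 2\<close>, the right side is
        at least \<open>t * \<eta> / 4\<close>. On the left stand the second-order loss, the density
        defect, the boosts and the deficit of \<open>V\<close>.\<close>
      have 2: "2 * \<eta>\<^sup>2 * k + t * (16 * \<epsilon>) + D * 32 + real k / 655360000000000000000 \<le> (real t - s) * \<eta> / 2"
        using kt st t0 by (simp add: \<eta>_def \<epsilon>_def D_def power2_eq_square)
      have 3: "(2 * real k - s - t) * ln 2 + t * ln 2 = (2 * real k - s) * ln 2" by (simp add: algebra_simps)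
      have "0 \<le> real s * \<epsilon>" by (simp add: \<epsilon>_def)
      then show ?thesis using 1 2 3 low unfolding M_def by linarith
    qed
    then show "exp M * exp ((t + D * ln (4 / (2 * \<epsilon>))) * - ln (1 / 2 - 4 * \<epsilon>)) \<le> card W"
      using W0 by (simp add: mult_exp_exp ln_ge_iff)
  qed (use t10 A BD finW deg in \<open>simp_all add: \<epsilon>_def\<close>)
  then obtain c K Z where KW: "K \<subseteq> W" and ZW: "Z \<subseteq> W" and Km: "monochromatic c K" and Kc: "card K = t"
    and Zc: "real (card Z) \<ge> exp M" and KZ: "joined c K Z" by blast
  have j: "joined c (S c) K" using SW[of c] KW by (auto simp: joined_def)
  have m: "monochromatic c (S c \<union> K)" by (rule monochromatic_Un[OF Sm Km j])
  have SKV: "S c \<union> K \<subseteq> V" using SV KW WV by blast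
  have cU: "card (S c \<union> K) = card (S c) + t"
  proof -
    have "finite (S c)" "finite K" using SKV V finite_subset by auto
    from card_Un_disjoint[OF this monochromatic_Un(2)[OF Sm Km j]] Kc show ?thesis by simp
  qed
  then have ck: "card (S c) + t \<le> k" using no[OF SKV m] by simp
  let ?a = "k - (card (S c) + t)" and ?b = "k - card (S (\<not> c))"
  have "s \<le> t" using st by linarith
  \<comment> \<open>The spine lowers the remaining target in colour \<open>c\<close> by
    \<open>t\<close>, while the original cliques can offset at most \<open>s\<close> of this
    asymmetry.\<close>
  then have skew: "?a + (t - s) \<le> ?b" using ck ssum[of c] by arith
  have "joined c (S c \<union> K) Z" "joined (\<not> c) (S (\<not> c)) Z"
    using SW[of c] SW[of "\<not> c"] ZW KZ by (auto simp: joined_def)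
  then have "card Z < (?a + ?b) choose ?a"
    using card_lt_binomial[where c = c, OF no' V _ SKV SV m Sm] ZW WV unfolding cU by auto
  then have "real (card Z) < real ((?a + ?b) choose ?a)" by simp
  also have "\<dots> \<le> exp (real (?a + ?b) * ln 2 + 2 * \<eta>\<^sup>2 * ?a - (t - s) * \<eta> / 2)"
    by (rule binomial_le_skewed[OF _ _ skew]) (auto simp: \<eta>_def)
  also have "\<dots> \<le> exp M"
  proof -
    have "real (?a + ?b) = 2 * real k - s - t"
      using ck Sk[of "\<not> c"] ssum[of c] by (simp add: of_nat_diff flip: ssum[of c])
    moreover have "real (t - s) = real t - s" using st by (simp add: of_nat_diff)
    moreover have "2 * \<eta>\<^sup>2 * ?a \<le> 2 * \<eta>\<^sup>2 * k" by (intro mult_left_mono) auto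
    ultimately show ?thesis unfolding M_def by simp
  qed
  finally show False using Zc by simp
qed

end

section \<open>Ramsey numbers\<close>

text \<open>Colour \<open>True\<close> is the graph and \<open>False\<close> its complement off the
  diagonal, so every \<open>E\<close> gives a colouring and cliques and independent sets become
  monochromatic sets.\<close>

definition edge_colour :: "nat set set \<Rightarrow> bool \<Rightarrow> nat \<Rightarrow> nat \<Rightarrow> bool" where
  "edge_colour E c x y \<longleftrightarrow> x \<noteq> y \<and> ({x, y} \<in> E \<longleftrightarrow> c)"

interpretation edge_colour: edge_colouring "edge_colour E" for E
  by unfold_locales (auto simp: edge_colour_def insert_commute)

lemma ramsey_number_diagonal_le:
  assumes "n > 0"
    and "\<And>E. \<exists>c K. K \<subseteq> {0..<n} \<and> card K = k \<and> edge_colour.monochromatic E c K"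
  shows "ramsey_number k k \<le> n"
proof -
  have "ramsey_prop k k n"
    unfolding ramsey_prop_def
  proof (intro allI impI)
    fix E
    obtain c K where K: "K \<subseteq> {0..<n}" "card K = k" "edge_colour.monochromatic E c K"
      using assms(2) by blast
    show "(\<exists>K\<subseteq>{0..<n}. card K = k \<and> is_clique E K) \<or> (\<exists>I\<subseteq>{0..<n}. card I = k \<and> is_indep E I)"
    proof (cases c)
      case True
      then have "is_clique E K"
        using K(3) by (auto simp: edge_colour.monochromatic_def edge_colour_def is_clique_def)
      then show ?thesis using K by blast
    next
      case False
      then have "is_indep E K"
        using K(3) by (auto simp: edge_colour.monochromatic_def edge_colour_def is_indep_def)
      then show ?thesis using K by blast
    qed
  qed
  then show ?thesis unfolding ramsey_number_def using assms(1) by (intro Least_le) simp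
qed

lemma ramsey_number_less_binomial:
  assumes "k \<ge> 3"
  shows "ramsey_number (k + 1) (k + 1) < (2 * k) choose k"
proof -
  have "4 ^ 3 / (2 * real 3) \<le> 4 ^ k / (2 * real k)" if "k \<ge> 3" for k
    using that
  proof (induction k rule: dec_induct)
    case (step k)
    have "4 ^ k / (2 * real k) \<le> 4 ^ Suc k / (2 * real (Suc k))"
      using step.hyps by (simp add: field_simps)
    then show ?case using step.IH by linarith
  qed simp
  from this[OF assms] have "10 < 4 ^ k / (2 * real k)" by simp
  also have "\<dots> \<le> real ((2 * k) choose k)"
    using assms by (intro central_binomial_lower_bound) auto
  finally have big: "(2 * k) choose k > 10" by simp
  have "ramsey_number (k + 1) (k + 1) \<le> ((2 * k) choose k) - 1"
  proof (rule ramsey_number_diagonal_le)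
    fix E
    have "(\<exists>K\<subseteq>{0..<((2 * k) choose k) - 1}. card K = Suc k \<and> edge_colour.monochromatic E True K) \<or>
        (\<exists>K\<subseteq>{0..<((2 * k) choose k) - 1}. card K = Suc k \<and> edge_colour.monochromatic E (\<not> True) K)"
      using assms big by (intro edge_colour.erdos_szekeres_strict) (auto simp: mult_2)
    then show "\<exists>c K. K \<subseteq> {0..<((2 * k) choose k) - 1} \<and> card K = k + 1 \<and> edge_colour.monochromatic E c K"
      by auto
  qed (use big in simp)
  then show ?thesis using big by linarith
qed

lemma ramsey_number_exponential:
  assumes "10 ^ 26 \<le> real (k div 100000000)"
  shows "real (ramsey_number (k + 1) (k + 1)) \<le> 2 * (4 ^ k * exp (- real k / 655360000000000000000))"
proof -
  define x where "x = 4 ^ k * exp (- real k / 655360000000000000000)"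
  have "exp (1::real) \<le> 4" using exp_le by linarith
  then have "exp 1 ^ k \<le> (4::real) ^ k" by (intro power_mono) auto
  then have "exp (real k) \<le> 4 ^ k" using exp_of_nat_mult[of k "1::real"] by simp
  then have "exp (real k) * exp (- real k / 655360000000000000000) \<le> x"
    unfolding x_def by (intro mult_right_mono) auto
  moreover have "1 \<le> exp (real k) * exp (- real k / 655360000000000000000)"
    unfolding mult_exp_exp by simp
  ultimately have x1: "1 \<le> x" by linarith
  \<comment> \<open>Rounding up adds at most 1 \<le> x, whence the factor 2 in the bound.\<close>
  have n: "x \<le> real (nat \<lceil>x\<rceil>)" "real (nat \<lceil>x\<rceil>) \<le> x + 1" using x1 by linarith+
  have "ramsey_number (k + 1) (k + 1) \<le> nat \<lceil>x\<rceil>"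
  proof (rule ramsey_number_diagonal_le)
    show "\<exists>c K. K \<subseteq> {0..<nat \<lceil>x\<rceil>} \<and> card K = k + 1 \<and> edge_colour.monochromatic E c K" for E
      using n by (intro edge_colour.diagonal_large assms) (auto simp: x_def)
  qed (use x1 in simp)
  then have "real (ramsey_number (k + 1) (k + 1)) \<le> real (nat \<lceil>x\<rceil>)" by simp
  then show ?thesis using n(2) x1 unfolding x_def[symmetric] by linarith
qed

lemma eventually_ramsey_number_le:
  "eventually (\<lambda>k. real (ramsey_number (k + 1) (k + 1))
     \<le> exp (- (ln (real k))\<^sup>2) * real ((2 * k) choose k)) at_top"
proof -
  \<comment> \<open>The terms \<open>ln 4 + ln k\<close> absorb both the rounding factor 2 and the
    factor \<open>2 * k\<close> in the lower bound for the central binomial coefficient.\<close>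
  have "eventually (\<lambda>k::nat. ln 4 + ln (real k) + (ln (real k))\<^sup>2 \<le> real k / 655360000000000000000) at_top"
    by real_asymp
  moreover have "eventually (\<lambda>k::nat. k \<ge> 10 ^ 34) at_top" by (rule eventually_ge_at_top)
  ultimately show ?thesis
  proof eventually_elim
    case (elim k)
    have k0: "k > 0" using elim(2) by (rule less_le_trans[rotated]) simp
    have "10 ^ 34 div 100000000 \<le> k div 100000000" using elim(2) by (rule div_le_mono)
    then have "10 ^ 26 \<le> k div 100000000" by simp
    then have "10 ^ 26 \<le> real (k div 100000000)" 
      using of_nat_mono[of "10 ^ 26" "k div 100000000", where 'a = real] by simp
    then have "real (ramsey_number (k + 1) (k + 1)) \<le> 2 * (4 ^ k * exp (- real k / 655360000000000000000))"
      by (rule ramsey_number_exponential)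
    also have "\<dots> \<le> 2 * (4 ^ k * exp (- (ln 4 + ln (real k) + (ln (real k))\<^sup>2)))"
      using elim(1) by simp
    also have "\<dots> = exp (- (ln (real k))\<^sup>2) * (4 ^ k / (2 * real k))"
      using k0 by (simp add: exp_add exp_diff exp_minus field_simps)
    also have "\<dots> \<le> exp (- (ln (real k))\<^sup>2) * real ((2 * k) choose k)"
      using k0 by (intro mult_left_mono central_binomial_lower_bound) auto
    finally show ?case .
  qed
qed

section \<open>One constant for small and large k\<close>

lemma finite_positive_lower_bound:
  fixes f :: "'b \<Rightarrow> real"
  assumes "finite S" "\<And>x. x \<in> S \<Longrightarrow> f x > 0"
  shows "\<exists>c>0. \<forall>x\<in>S. c \<le> f x"
  using assms
proof induction
  case empty
  then show ?case by (auto intro: exI[of _ 1])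
next
  case (insert x S)
  then obtain c where "c > 0" "\<forall>x\<in>S. c \<le> f x" by auto
  then show ?case using insert.prems[of x] by (intro exI[of _ "min c (f x)"]) auto
qed

theorem theorem1p1:
  shows "\<exists>c::real. c > 0 \<and> (\<forall>k::nat. k \<ge> 3 \<longrightarrow>
           real (ramsey_number (k + 1) (k + 1))
             \<le> exp (- c * (ln (real k))\<^sup>2) * real ((2 * k) choose k))"
proof -
  obtain K where K: "\<And>k. k \<ge> K \<Longrightarrow> real (ramsey_number (k + 1) (k + 1))
      \<le> exp (- (ln (real k))\<^sup>2) * real ((2 * k) choose k)"
    using eventually_ramsey_number_le unfolding eventually_at_top_linorder by blast
  define b where "b k = real ((2 * k) choose k)" for k
  \<comment> \<open>Integrality turns the strict inequality into a gap; a gap of 1/2 keeps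
    \<open>b k - 1 / 2\<close> positive from \<open>b k \<ge> 1\<close> alone.\<close>
  have b: "b k \<ge> 1" "real (ramsey_number (k + 1) (k + 1)) \<le> b k - 1 / 2" if "k \<ge> 3" for k
    using ramsey_number_less_binomial[OF that] by (simp_all add: b_def)
  \<comment> \<open>The constant for which the desired bound at \<open>k\<close> equals
    \<open>b k - 1 / 2\<close>; its minimum over the finitely many small \<open>k\<close> is
    positive.\<close>
  define f where "f k = ln (b k / (b k - 1 / 2)) / (ln (real k))\<^sup>2" for k
  have "f k > 0" if "k \<in> {3..<K}" for k
    using that b(1)[of k] by (auto simp: f_def intro!: divide_pos_pos)
  then obtain c where c: "c > 0" "\<And>k. k \<in> {3..<K} \<Longrightarrow> c \<le> f k"
    using finite_positive_lower_bound[of "{3..<K}" f] by auto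
  show ?thesis
  proof (intro exI[of _ "min c 1"] conjI allI impI)
    fix k :: nat
    assume k: "k \<ge> 3"
    show "real (ramsey_number (k + 1) (k + 1)) \<le> exp (- min c 1 * (ln (real k))\<^sup>2) * real ((2 * k) choose k)"
    proof (cases "k \<ge> K")
      case True
      have "min c 1 * (ln (real k))\<^sup>2 \<le> 1 * (ln (real k))\<^sup>2" by (intro mult_right_mono) auto
      then have "exp (- (ln (real k))\<^sup>2) * real ((2 * k) choose k)
          \<le> exp (- min c 1 * (ln (real k))\<^sup>2) * real ((2 * k) choose k)"
        by (intro mult_right_mono) auto
      then show ?thesis using K[OF True] by linarith
    next
      case False
      have l: "(ln (real k))\<^sup>2 > 0" using k by simp
      have "min c 1 * (ln (real k))\<^sup>2 \<le> f k * (ln (real k))\<^sup>2"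
        using c(2)[of k] False k by (intro mult_right_mono) auto
      also have "\<dots> = ln (b k / (b k - 1 / 2))" using l by (simp add: f_def)
      finally have "exp (- ln (b k / (b k - 1 / 2))) \<le> exp (- min c 1 * (ln (real k))\<^sup>2)" by simp
      moreover have "exp (- ln (b k / (b k - 1 / 2))) = (b k - 1 / 2) / b k"
        using b(1)[OF k] by (simp add: exp_minus)
      ultimately have "(b k - 1 / 2) / b k * b k \<le> exp (- min c 1 * (ln (real k))\<^sup>2) * b k"
        using b(1)[OF k] by (intro mult_right_mono) auto
      then show ?thesis using b[OF k] by (simp add: b_def)
    qed
  qed (use c in simp)
qed

end
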